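(* Let $T>0$. Let $\{A_{t,x}\}_{(t,x)\in[0,T]\times\mathbb{R}^n}$ be a family of maximal monotone operators $A_{t,x}:\mathbb{R}^n\rightrightarrows\mathbb{R}^n$ such that: (1.1) there are constants $L_1\ge 0$ and $0\le L_2<1$ with $\mathrm{dis}(A_{t,x},A_{s,y})\le L_1|t-s|+L_2\|x-y\|$ for all $t,s\in[0,T]$ and $x,y\in\mathbb{R}^n$; (1.2) there is $c_A>0$ with $\|A^0_{t,x}(y)\|\le c_A(1+\|x\|+\|y\|)$ for all $t\in[0,T]$, $x\in\mathbb{R}^n$ and $y\in\mathrm{dom}(A_{t,x})$. Let $f:[0,T]\times\mathbb{R}^n\to\mathbb{R}^n$ be continuous and suppose there is $c_f>0$ with $\|f(t,x)\|\le c_f(1+\|x\|)$ for all $t\in[0,T]$, $x\in\mathbb{R}^n$. Suppose in addition that for every $M>0$ there exist $k_M,l_M>0$ such that for all $t\in[0,T]$, all $x_1,x_2\in\mathbb{R}^n$ with $\|x_i\|\le M$, and all $x_i^*\in A_{t,x_i}(x_i)$, $i=1,2$, $$\langle x_1^*-x_2^*,x_1-x_2\rangle\ge -k_M\|x_1-x_2\|^2,$$ and, for all $t\in[0,T]$ and all $x_1,x_2\in\mathbb{R}^n$ with $\|x_i\|\le M$, $$\|f(t,x_1)-f(t,x_2)\|\le l_M\|x_1-x_2\|.$$ Then for every $t_0\in[0,T]$ and $x_0\in\mathrm{dom}(A_{t_0,x_0})$, the problem $$\dot x(t)\in f(t,x(t))-A_{t,x(t)}(x(t))\ \text{ for a.e.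 } t\in[t_0,T],\qquad x(t_0)=x_0,$$ has a unique solution on $[t_0,T]$.
   Context: For a set-valued operator $F:\mathbb{R}^n\rightrightarrows\mathbb{R}^n$, $\mathrm{dom}(F)=\{z: F(z)\neq\emptyset\}$. For a maximal monotone $F$ and $z\in\mathrm{dom}(F)$, $F^0(z)$ denotes the element of minimal norm of the closed convex set $F(z)$. The (Vladimirov) pseudo-distance between two maximal monotone operators $F_1,F_2$ is $$\mathrm{dis}(F_1,F_2):=\sup\Big\{\frac{\langle\eta_1-\eta_2,z_2-z_1\rangle}{1+\|\eta_1\|+\|\eta_2\|}:\ z_i\in\mathrm{dom}(F_i),\ \eta_i\in F_i(z_i),\ i=1,2\Big\}.$$ A solution is an absolutely continuous function $x:[t_0,T]\to\mathbb{R}^n$ with $x(t_0)=x_0$ satisfying the inclusion for almost every $t$. *)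

theory Defs
  imports "HOL-Analysis.Analysis"
begin

section \<open>Set-valued operators\<close>

text \<open>A set-valued operator on a space \<open>'a\<close> is a function \<open>F :: 'a \<Rightarrow> 'a set\<close>.\<close>

definition op_dom :: "('a \<Rightarrow> 'a set) \<Rightarrow> 'a set" where
  "op_dom F = {z. F z \<noteq> {}}"

definition monotone_op :: "('a::real_inner \<Rightarrow> 'a set) \<Rightarrow> bool" where
  "monotone_op F \<longleftrightarrow>
     (\<forall>z1 z2. \<forall>\<eta>1\<in>F z1. \<forall>\<eta>2\<in>F z2. (\<eta>1 - \<eta>2) \<bullet> (z1 - z2) \<ge> 0)"

definition maximal_monotone :: "('a::real_inner \<Rightarrow> 'a set) \<Rightarrow> bool" where
  "maximal_monotone F \<longleftrightarrow>
     monotone_op F \<and> (\<forall>G. monotone_op G \<and> (\<forall>z. F z \<subseteq> G z) \<longrightarrow> G = F)"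

text \<open>
  The operator \<open>F\<^sup>0\<close>. Only meaningful at \<open>z \<in> op_dom F\<close>, where for a maximal monotone \<open>F\<close>
  on a Euclidean space the set \<open>F z\<close> is nonempty, closed and convex, so that the minimiser
  exists and is unique.
\<close>

definition minimal_section :: "('a::real_inner \<Rightarrow> 'a set) \<Rightarrow> 'a \<Rightarrow> 'a" where
  "minimal_section F z = arg_min_on norm (F z)"

text \<open>Vladimirov's pseudo-distance; extended-real valued because the supremum may be infinite.\<close>

definition pseudo_dist ::
  "('a::real_inner \<Rightarrow> 'a set) \<Rightarrow> ('a \<Rightarrow> 'a set) \<Rightarrow> ereal" where
  "pseudo_dist F1 F2 =
     Sup {ereal (((\<eta>1 - \<eta>2) \<bullet> (z2 - z1)) / (1 + norm \<eta>1 + norm \<eta>2)) | z1 z2 \<eta>1 \<eta>2.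
            z1 \<in> op_dom F1 \<and> z2 \<in> op_dom F2 \<and> \<eta>1 \<in> F1 z1 \<and> \<eta>2 \<in> F2 z2}"

section \<open>Solutions of differential inclusions\<close>

text \<open>
  The usual \<open>\<epsilon>\<close>-\<open>\<delta>\<close> definition of absolute continuity: \<open>D division_of \<Union>D\<close> says that \<open>D\<close> is a
  finite set of nonempty compact intervals with pairwise disjoint interiors; \<open>Inf K\<close> and \<open>Sup K\<close>
  are the endpoints of \<open>K\<close>.
\<close>

definition absolutely_continuous_on :: "real set \<Rightarrow> (real \<Rightarrow> 'a::real_normed_vector) \<Rightarrow> bool" where
  "absolutely_continuous_on S x \<longleftrightarrow>
     (\<forall>\<epsilon>>0. \<exists>\<delta>>0. \<forall>D. D division_of \<Union>D \<and> \<Union>D \<subseteq> S \<and> (\<Sum>K\<in>D. Sup K - Inf K) < \<delta>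
        \<longrightarrow> (\<Sum>K\<in>D. norm (x (Sup K) - x (Inf K))) < \<epsilon>)"

text \<open>
  \<open>x\<close> solves \<open>x'(t) \<in> f(t, x(t)) - A\<^bsub>t,x(t)\<^esub>(x(t))\<close> for almost every \<open>t\<close> in \<open>[t0, T]\<close>, \<open>x(t0) = x0\<close>.
  Only the values of the total function \<open>x\<close> on \<open>[t0, T]\<close> matter.
\<close>

definition is_solution ::
  "(real \<Rightarrow> 'a \<Rightarrow> 'a \<Rightarrow> 'a set) \<Rightarrow> (real \<Rightarrow> 'a \<Rightarrow> 'a) \<Rightarrow> real \<Rightarrow> real \<Rightarrow> 'a::euclidean_space
     \<Rightarrow> (real \<Rightarrow> 'a) \<Rightarrow> bool" where
  "is_solution A f T t0 x0 x \<longleftrightarrow>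
     absolutely_continuous_on {t0..T} x \<and> x t0 = x0 \<and>
     (AE t in lebesgue_on {t0..T}.
        \<exists>v. (x has_vector_derivative v) (at t within {t0..T}) \<and>
            v \<in> {f t (x t) - w | w. w \<in> A t (x t) (x t)})"

end

(*
  Existence. The nodes x(i+1) of the polygons are obtained from x(i) by a resolvent step for the
  operator A frozen at (t(i+1), x(i)). Comparing the new velocity with the minimal section at the old
  node through Vladimirov's distance shows, because L2 < 1, that the velocities stay bounded by a
  multiple of 1 + sup |x|, so the polygons are equi-Lipschitz and have a uniform limit g.
  No weak compactness of the derivatives is needed: summing the monotonicity inequalities of the scheme
  over a short interval [t, t + d] and dividing by d yields, at every point t where g is differentiable,
  the inequality that characterises f(t, g t) - g'(t) as an element of the maximal monotone operator.
  Lipschitz functions are differentiable almost everywhere.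

  Uniqueness is Gronwall's inequality for |x - y|^2.
*)
theory Submission
  imports Defs "HOL-Complex_Analysis.Great_Picard"
begin

section \<open>Maximal monotone operators\<close>

text \<open>The obstacle is that a new node is controlled only through the previous velocity. With w
  the new velocity, \<sigma> the old speed and a a bound of order 1 + sup |x|, the comparison
  through the distance gives |w|^2 \<le> a |w| + (L1 + L2 \<sigma>) (1 + a + |w|). If |w| exceeds
  both \<sigma> and 1, this forces |w| \<le> L2 \<sigma> + O(1 + a): a factor below 1 keeps the
  speeds from compounding from step to step. The passage to the limit works because, against a fixed
  pair (u, \<eta>) of the operator at (t, g t), the monotonicity inequality is linear in the
  velocity. It can be added over steps and survives uniform convergence of the polygons, while the
  velocities themselves may oscillate. Three classical facts carry the rest: Minty's theorem,
  obtained from finite subsets of the graph by duality and compactness; Lebesgue's differentiation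
  theorem, obtained by comparing slopes over Vitali covers; and the monotonicity of an absolutely
  continuous function with nonpositive derivative almost everywhere, obtained from a gauge.\<close>

lemma maximal_monotone_memI:
  assumes F: "maximal_monotone F"
    and w: "\<And>u \<eta>. \<eta> \<in> F u \<Longrightarrow> (\<eta> - w) \<bullet> (u - x) \<ge> 0"
  shows "w \<in> F x"
proof -
  \<comment> \<open>The graph of \<open>F\<close> is enlarged by the single pair
    \<open>(x, w)\<close>. It stays monotone, so by maximality the pair was there already.\<close>
  define G where "G = F(x := insert w (F x))"
  have mono: "(\<eta>1 - \<eta>2) \<bullet> (z1 - z2) \<ge> 0" if "\<eta>1 \<in> F z1" "\<eta>2 \<in> F z2" for \<eta>1 \<eta>2 z1 z2
    using F that unfolding maximal_monotone_def monotone_op_def by blast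
  have w': "(w - \<eta>) \<bullet> (x - u) \<ge> 0" if "\<eta> \<in> F u" for u \<eta>
    using w[OF that] by (simp add: inner_diff_left inner_diff_right)
  have "monotone_op G"
    unfolding monotone_op_def G_def using mono w w' by (auto split: if_splits)
  moreover have "F z \<subseteq> G z" for z by (auto simp: G_def)
  ultimately have "G = F" using F unfolding maximal_monotone_def by blast
  then show ?thesis by (metis G_def fun_upd_same insertI1)
qed

text \<open>Being monotonically related to every pair of the graph is a family of closed half-space
  conditions on \<open>w\<close>, and by \<open>maximal_monotone_memI\<close> these describe
  \<open>F x\<close> exactly. Closedness is what makes the minimal norm attained.\<close>

lemma maximal_monotone_closed:
  assumes F: "maximal_monotone F"
  shows "closed (F x)"
proof -
  have "F x = (\<Inter>u. \<Inter>\<eta>\<in>F u. {w. (\<eta> - w) \<bullet> (u - x) \<ge> 0})"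
  proof
    show "F x \<subseteq> (\<Inter>u. \<Inter>\<eta>\<in>F u. {w. (\<eta> - w) \<bullet> (u - x) \<ge> 0})"
      using F unfolding maximal_monotone_def monotone_op_def by blast
    show "(\<Inter>u. \<Inter>\<eta>\<in>F u. {w. (\<eta> - w) \<bullet> (u - x) \<ge> 0}) \<subseteq> F x"
      by (auto intro: maximal_monotone_memI[OF F])
  qed
  moreover have "closed {w. (\<eta> - w) \<bullet> (u - x) \<ge> 0}" for u \<eta>
    by (intro closed_Collect_le continuous_intros)
  ultimately show ?thesis by (simp add: closed_INT)
qed

text \<open>\<open>arg_min_on\<close> is a choice operator, so membership rests on the existence of
  a minimiser: a point of the closed nonempty set nearest to the origin.\<close>

lemma minimal_section_mem:
  fixes F :: "'a::euclidean_space \<Rightarrow> 'a set"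
  assumes F: "maximal_monotone F" and z: "z \<in> op_dom F"
  shows "minimal_section F z \<in> F z"
proof -
  obtain w where "w \<in> F z" "\<And>y. y \<in> F z \<Longrightarrow> dist 0 w \<le> dist 0 y"
    using distance_attains_inf[OF maximal_monotone_closed[OF F]] z
    unfolding op_dom_def by blast
  then have "is_arg_min norm (\<lambda>x. x \<in> F z) w"
    by (auto simp: is_arg_min_linorder)
  then have "is_arg_min norm (\<lambda>x. x \<in> F z) (minimal_section F z)"
    unfolding minimal_section_def arg_min_on_def arg_min_def by (rule someI)
  then show ?thesis by (simp add: is_arg_min_linorder)
qed

lemma pseudo_dist_leD:
  assumes "pseudo_dist F1 F2 \<le> ereal c" and "\<eta>1 \<in> F1 z1" and "\<eta>2 \<in> F2 z2"
  shows "(\<eta>1 - \<eta>2) \<bullet> (z2 - z1) \<le> c * (1 + norm \<eta>1 + norm \<eta>2)"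
proof -
  have "ereal (((\<eta>1 - \<eta>2) \<bullet> (z2 - z1)) / (1 + norm \<eta>1 + norm \<eta>2)) \<le> pseudo_dist F1 F2"
    unfolding pseudo_dist_def op_dom_def using assms(2,3) by (intro Sup_upper) blast
  then have "((\<eta>1 - \<eta>2) \<bullet> (z2 - z1)) / (1 + norm \<eta>1 + norm \<eta>2) \<le> c"
    using assms(1) by (meson ereal_less_eq(3) order_trans)
  moreover have "1 + norm \<eta>1 + norm \<eta>2 > 0"
    by (simp add: add_pos_nonneg)
  ultimately show ?thesis by (simp add: pos_divide_le_eq)
qed

section \<open>Minty's theorem and resolvents in finite dimension\<close>

text \<open>Pairs of the graph are lifted by the pairing \<open>\<eta> \<bullet> u\<close>.
  Monotonicity against a fixed pair is a half-space condition on the lifted points and therefore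
  passes to the hull; a fixed hull point then takes the place of the fixed pair, and the same
  argument applies once more.\<close>

lemma monotone_convex_hull:
  fixes G :: "('a::real_inner \<times> 'a) set"
  assumes mono: "\<And>u \<eta> v \<zeta>. (u, \<eta>) \<in> G \<Longrightarrow> (v, \<zeta>) \<in> G \<Longrightarrow> (\<eta> - \<zeta>) \<bullet> (u - v) \<ge> 0"
    and "(y, e, s) \<in> convex hull ((\<lambda>(u, \<eta>). (u, \<eta>, \<eta> \<bullet> u)) ` G)"
  shows "e \<bullet> y \<le> s"
proof -
  let ?Q = "(\<lambda>(u, \<eta>). (u, \<eta>, \<eta> \<bullet> u)) ` G"
  have half: "convex hull ?Q \<subseteq> {(y', e', s'). e' \<bullet> u + \<eta> \<bullet> y' - s' \<le> r}"
    if "?Q \<subseteq> {(y', e', s'). e' \<bullet> u + \<eta> \<bullet> y' - s' \<le> r}" for u \<eta> :: 'a and r :: real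
  proof (rule hull_minimal[OF that])
    have "{(y', e', s'). e' \<bullet> u + \<eta> \<bullet> y' - s' \<le> r} = {p. (\<eta>, u, -1::real) \<bullet> p \<le> r}"
      by (auto simp: inner_commute algebra_simps)
    then show "convex {(y', e', s'). e' \<bullet> u + \<eta> \<bullet> y' - s' \<le> r}"
      by (simp only: convex_halfspace_le)
  qed
  have 1: "e \<bullet> u + \<eta> \<bullet> y - s \<le> \<eta> \<bullet> u" if "(u, \<eta>) \<in> G" for u \<eta>
  proof -
    have "?Q \<subseteq> {(y', e', s'). e' \<bullet> u + \<eta> \<bullet> y' - s' \<le> \<eta> \<bullet> u}"
      using mono[OF that] by (fastforce simp: inner_diff_left inner_diff_right)
    from half[OF this] assms(2) show ?thesis by blast
  qed
  have "?Q \<subseteq> {(y', e', s'). e' \<bullet> y + e \<bullet> y' - s' \<le> s}"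
    using 1 by (fastforce simp: algebra_simps)
  from half[OF this] assms(2) have "e \<bullet> y + e \<bullet> y - s \<le> s" by blast
  then show ?thesis by simp
qed

text \<open>
  With \<open>w = (u - \<eta> + z) / 2\<close> and \<open>c = (z - \<eta>) \<bullet> u\<close>, the claim at \<open>(u, \<eta>)\<close> reads
  \<open>|x|\<^sup>2 - 2 x \<bullet> w + c \<le> 0\<close>. The dual function \<open>c - |w|\<^sup>2\<close> is nonpositive on the convex hull by
  monotonicity, and its maximiser gives the point \<open>x = w\<close> by the first-order condition.
\<close>

lemma minty_finite:
  fixes G :: "('a::euclidean_space \<times> 'a) set"
  assumes mono: "\<And>u \<eta> v \<zeta>. (u, \<eta>) \<in> G \<Longrightarrow> (v, \<zeta>) \<in> G \<Longrightarrow> (\<eta> - \<zeta>) \<bullet> (u - v) \<ge> 0"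
    and fin: "finite G"
  shows "\<exists>x. \<forall>(u, \<eta>)\<in>G. (\<eta> - z + x) \<bullet> (x - u) \<le> 0"
proof (cases "G = {}")
  case False
  define H where "H = convex hull ((\<lambda>(u, \<eta>). (u, \<eta>, \<eta> \<bullet> u)) ` G)"
  define W where "W = (\<lambda>(y, e, s::real). (y - e + z) /\<^sub>R 2)"
  define C where "C = (\<lambda>(y, e::'a, s). z \<bullet> y - s)"
  define \<Phi> where "\<Phi> p = C p - W p \<bullet> W p" for p
  have "compact H" unfolding H_def using fin by (intro finite_imp_compact_convex_hull) auto
  moreover have "H \<noteq> {}" using False by (auto simp: H_def)
  moreover have "continuous_on H \<Phi>"
    unfolding \<Phi>_def C_def W_def case_prod_beta by (intro continuous_intros)
  ultimately obtain p where p: "p \<in> H" "\<And>q. q \<in> H \<Longrightarrow> \<Phi> q \<le> \<Phi> p"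
    using continuous_attains_sup[of H \<Phi>] by blast
  obtain y e s where yes: "p = (y, e, s)" by (cases p)
  have "e \<bullet> y \<le> s" using monotone_convex_hull[of G y e s] mono p(1) unfolding H_def yes by blast
  \<comment> \<open>Once \<open>s\<close> is replaced by the smaller \<open>e \<bullet> y\<close>,
    the sign comes from the identity \<open>y \<bullet> b - |y + b|^2 / 4 = - |y - b|^2 / 4\<close>
    with \<open>b = z - e\<close>.\<close>
  have "\<Phi> p = (z \<bullet> y - s) - ((y - e + z) \<bullet> (y - e + z)) / 4"
    by (simp add: \<Phi>_def C_def W_def yes)
  also have "\<dots> \<le> (z \<bullet> y - e \<bullet> y) - ((y - e + z) \<bullet> (y - e + z)) / 4"
    using \<open>e \<bullet> y \<le> s\<close> by simp
  also have "\<dots> = - ((z - e - y) \<bullet> (z - e - y)) / 4"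
    by (simp add: inner_diff_left inner_diff_right inner_add_left inner_add_right inner_commute
        field_simps)
  also have "\<dots> \<le> 0" by simp
  finally have \<Phi>p: "\<Phi> p \<le> 0" .
  \<comment> \<open>The maximiser is perturbed towards \<open>q\<close>. Along the segment
    \<open>C\<close> and \<open>W\<close> are affine, so \<open>\<Phi>\<close> is quadratic in
    \<open>t\<close>; dividing by \<open>t\<close> and letting it tend to 0 leaves the linear
    term.\<close>
  have first_order: "C q - C p - 2 * (W p \<bullet> (W q - W p)) \<le> 0" if q: "q \<in> H" for q
  proof -
    let ?l = "C q - C p - 2 * (W p \<bullet> (W q - W p))" and ?n = "(W q - W p) \<bullet> (W q - W p)"
    have le: "?l \<le> t * ?n" if t: "0 < t" "t \<le> 1" for t
    proof -
      let ?q = "(1 - t) *\<^sub>R p + t *\<^sub>R q"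
      have "?q \<in> H"
        using convexD[OF convex_convex_hull p(1)[unfolded H_def] q[unfolded H_def], of "1 - t" t] t
        by (simp add: H_def)
      then have "\<Phi> ?q \<le> \<Phi> p" by (rule p(2))
      moreover have "C ?q = C p + t * (C q - C p)"
        by (simp add: C_def case_prod_beta inner_add_right algebra_simps)
      moreover have "W ?q = W p + t *\<^sub>R (W q - W p)"
        by (simp add: W_def case_prod_beta algebra_simps flip: scaleR_add_left)
      ultimately have "C p + t * (C q - C p) - (W p + t *\<^sub>R (W q - W p)) \<bullet> (W p + t *\<^sub>R (W q - W p))
          \<le> C p - W p \<bullet> W p"
        unfolding \<Phi>_def by (simp only:)
      moreover have "(W p + t *\<^sub>R (W q - W p)) \<bullet> (W p + t *\<^sub>R (W q - W p))
          = W p \<bullet> W p + t * (2 * (W p \<bullet> (W q - W p))) + t * (t * ?n)"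
        by (simp add: inner_add_left inner_add_right inner_commute)
      ultimately have "t * ?l \<le> t * (t * ?n)"
        by (simp add: right_diff_distrib)
      then show ?thesis using t by simp
    qed
    have "((\<lambda>t. t * ?n) \<longlongrightarrow> 0 * ?n) (at_right 0)"
      by (intro tendsto_intros)
    moreover have "eventually (\<lambda>t. ?l \<le> t * ?n) (at_right 0)"
      unfolding eventually_at_right_field using le by (intro exI[of _ 1]) auto
    ultimately show ?thesis
      using tendsto_lowerbound[of "\<lambda>t. t * ?n" 0 "at_right 0" ?l] by simp
  qed
  \<comment> \<open>At a lifted pair the required expression is exactly the first-order expression
    plus \<open>\<Phi> p\<close>, and both are nonpositive.\<close>
  have "(\<eta> - z + W p) \<bullet> (W p - u) \<le> 0" if "(u, \<eta>) \<in> G" for u \<eta>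
  proof -
    let ?q = "(u, \<eta>, \<eta> \<bullet> u)"
    have "?q \<in> H" unfolding H_def using that by (intro hull_inc) force
    note fo = first_order[OF this]
    have u: "2 *\<^sub>R W ?q = u - \<eta> + z" by (simp add: W_def)
    have "(\<eta> - z + W p) \<bullet> (W p - u) = W p \<bullet> W p - W p \<bullet> (2 *\<^sub>R W ?q) + C ?q"
      unfolding u by (simp add: C_def inner_add_left inner_add_right inner_diff_left inner_diff_right
            inner_commute algebra_simps)
    also have "\<dots> = (C ?q - C p - 2 * (W p \<bullet> (W ?q - W p))) + \<Phi> p"
      by (simp add: \<Phi>_def inner_diff_right algebra_simps)
    finally show ?thesis using fo \<Phi>p by simp
  qed
  then show ?thesis by blast
qed auto

text \<open>The condition that one pair \<open>(u, \<eta>)\<close> imposes on \<open>x\<close>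
  describes a closed ball (possibly empty) centred at \<open>(u - \<eta> + z) / 2\<close>. The sets
  are compact, so the finite intersection property carries \<open>minty_finite\<close> over to the
  whole graph.\<close>

lemma minty:
  fixes G :: "('a::euclidean_space \<times> 'a) set"
  assumes mono: "\<And>u \<eta> v \<zeta>. (u, \<eta>) \<in> G \<Longrightarrow> (v, \<zeta>) \<in> G \<Longrightarrow> (\<eta> - \<zeta>) \<bullet> (u - v) \<ge> 0"
  shows "\<exists>x. \<forall>(u, \<eta>)\<in>G. (\<eta> - z + x) \<bullet> (x - u) \<le> 0"
proof -
  define S where "S = (\<lambda>(u, \<eta>). {x. (\<eta> - z + x) \<bullet> (x - u) \<le> 0})"
  have "compact (S g)" for g
  proof -
    obtain u \<eta> where g: "g = (u, \<eta>)" by (cases g)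
    define w where "w = (u - \<eta> + z) /\<^sub>R 2"
    have w: "u - \<eta> + z = 2 *\<^sub>R w" by (simp add: w_def)
    have "norm (x - w) \<le> sqrt (w \<bullet> w - (z - \<eta>) \<bullet> u)" if "x \<in> S g" for x
    proof -
      have "(\<eta> - z + x) \<bullet> (x - u) = x \<bullet> x - x \<bullet> (u - \<eta> + z) + (z - \<eta>) \<bullet> u"
        by (simp add: inner_add_left inner_add_right inner_diff_left inner_diff_right
            inner_commute algebra_simps)
      then have "(norm (x - w))\<^sup>2 \<le> w \<bullet> w - (z - \<eta>) \<bullet> u"
        using that unfolding w S_def g power2_norm_eq_inner
        by (simp add: inner_diff_left inner_diff_right inner_commute)
      then show ?thesis by (simp add: real_le_rsqrt)
    qed
    then have "S g \<subseteq> cball w (sqrt (w \<bullet> w - (z - \<eta>) \<bullet> u))"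
      by (auto simp: dist_norm norm_minus_commute)
    moreover have "closed (S g)"
      unfolding S_def g prod.case by (intro closed_Collect_le continuous_intros)
    ultimately show ?thesis
      using bounded_subset[OF bounded_cball] compact_eq_bounded_closed by blast
  qed
  moreover have "\<Inter>\<F> \<noteq> {}" if \<F>: "finite \<F>" "\<F> \<subseteq> S ` G" for \<F>
  proof -
    obtain G' where G': "G' \<subseteq> G" "finite G'" "\<F> = S ` G'"
      using finite_subset_image[OF \<F>] by blast
    obtain x where "\<forall>(u, \<eta>)\<in>G'. (\<eta> - z + x) \<bullet> (x - u) \<le> 0"
      using minty_finite[of G'] mono G' by blast
    then have "x \<in> \<Inter>\<F>" unfolding G'(3) S_def by auto
    then show ?thesis by blast
  qed
  ultimately have "\<Inter>(S ` G) \<noteq> {}"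
    using compact_fip_Heine_Borel[of "S ` G"] by (metis imageE)
  then show ?thesis unfolding S_def by fastforce
qed

text \<open>\<open>minty\<close> is applied to the graph of \<open>F\<close> scaled by
  \<open>h\<close>. It yields a \<open>y\<close> for which \<open>(z - y) / h\<close> is
  monotonically related to all of \<open>F\<close>, and maximality turns this into
  membership.\<close>

lemma resolvent_exists:
  fixes F :: "'a::euclidean_space \<Rightarrow> 'a set"
  assumes F: "maximal_monotone F" and h: "h > 0"
  shows "\<exists>y. (z - y) /\<^sub>R h \<in> F y"
proof -
  have mono: "(\<eta> - \<zeta>) \<bullet> (u - v) \<ge> 0" if "\<eta> \<in> F u" "\<zeta> \<in> F v" for u v \<eta> \<zeta>
    using F that unfolding maximal_monotone_def monotone_op_def by blast
  let ?G = "{(u, h *\<^sub>R \<eta>) | u \<eta>. \<eta> \<in> F u}"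
  have "(\<eta> - \<zeta>) \<bullet> (u - v) \<ge> 0" if "(u, \<eta>) \<in> ?G" "(v, \<zeta>) \<in> ?G" for u v \<eta> \<zeta>
    using that mono h by (auto simp flip: scaleR_diff_right)
  from minty[of ?G, OF this]
  obtain y where y: "\<forall>(u, \<eta>)\<in>?G. (\<eta> - z + y) \<bullet> (y - u) \<le> 0" by blast
  have "(\<eta> - (z - y) /\<^sub>R h) \<bullet> (u - y) \<ge> 0" if "\<eta> \<in> F u" for u \<eta>
  proof -
    have "(h *\<^sub>R \<eta> - z + y) \<bullet> (y - u) \<le> 0" using y that by blast
    moreover have "h *\<^sub>R \<eta> - z + y = h *\<^sub>R (\<eta> - (z - y) /\<^sub>R h)"
      using h by (simp add: algebra_simps)
    ultimately have "h * ((\<eta> - (z - y) /\<^sub>R h) \<bullet> (y - u)) \<le> 0" by simp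
    then have "(\<eta> - (z - y) /\<^sub>R h) \<bullet> (y - u) \<le> 0" using h by (simp add: mult_le_0_iff)
    then show ?thesis by (simp add: inner_diff_right)
  qed
  then show ?thesis using maximal_monotone_memI[OF F] by blast
qed

section \<open>Absolutely continuous functions\<close>

lemma absolutely_continuous_on_subset:
  "absolutely_continuous_on S x \<Longrightarrow> R \<subseteq> S \<Longrightarrow> absolutely_continuous_on R x"
  unfolding absolutely_continuous_on_def by (meson subset_trans)

text \<open>A tagged division fine for a suitable gauge separates two kinds of intervals. At tags
  outside \<open>N\<close> the derivative bounds the increment by \<open>\<epsilon>\<close> times
  the length; the intervals tagged in \<open>N\<close> lie in an open set of measure below
  \<open>\<delta>\<close>, where absolute continuity takes over.\<close>

lemma absolutely_continuous_antimono:
  fixes \<phi> :: "real \<Rightarrow> real"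
  assumes ac: "absolutely_continuous_on {a..b} \<phi>" and ab: "a \<le> b"
    and N: "negligible N"
    and deriv: "\<And>t. t \<in> {a..b} - N \<Longrightarrow>
      \<exists>v\<le>0. (\<phi> has_vector_derivative v) (at t within {a..b})"
  shows "\<phi> b \<le> \<phi> a"
proof (rule field_le_epsilon)
  fix e :: real assume "e > 0"
  \<comment> \<open>The two kinds of intervals will contribute at most
    \<open>\<epsilon> * (b - a)\<close> and \<open>\<epsilon>\<close>.\<close>
  define \<epsilon> where "\<epsilon> = e / (b - a + 1)"
  have \<epsilon>: "\<epsilon> > 0" using \<open>e > 0\<close> ab by (simp add: \<epsilon>_def)
  obtain \<delta> where \<delta>: "\<delta> > 0" and ac\<delta>: "\<And>D. D division_of \<Union>D \<Longrightarrow> \<Union>D \<subseteq> {a..b} \<Longrightarrow>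
      (\<Sum>K\<in>D. Sup K - Inf K) < \<delta> \<Longrightarrow> (\<Sum>K\<in>D. norm (\<phi> (Sup K) - \<phi> (Inf K))) < \<epsilon>"
    using ac \<epsilon> unfolding absolutely_continuous_on_def by meson
  obtain U where U: "open U" "N \<subseteq> U" "U - N \<in> lmeasurable" "emeasure lebesgue (U - N) < ennreal \<delta>"
    using sets_lebesgue_outer_open[OF negligible_imp_sets[OF N] \<delta>] .
  have UN: "U = (U - N) \<union> N" using U(2) by blast
  have U_lm: "U \<in> lmeasurable"
    by (subst UN) (intro fmeasurable.Un U(3) negligible_imp_measurable[OF N])
  have "measure lebesgue U \<le> measure lebesgue (U - N) + measure lebesgue N"
    by (subst UN) (intro measure_Un_le fmeasurableD U(3) negligible_imp_sets[OF N])
  also have "\<dots> < \<delta>"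
    using U(4) unfolding emeasure_eq_measure2[OF U(3)] negligible_imp_measure0[OF N]
    by (simp add: ennreal_less_iff)
  finally have U_meas: "U \<in> lmeasurable" "measure lebesgue U < \<delta>" using U_lm by simp_all
  \<comment> \<open>The estimate is split at \<open>t\<close> because a tag lies between the
    endpoints of its interval; adding the two sides bounds the increment over the whole
    interval.\<close>
  have "\<exists>d>0. \<forall>y\<in>{a..b}. \<bar>y - t\<bar> < d \<longrightarrow>
      (t \<le> y \<longrightarrow> \<phi> y - \<phi> t \<le> \<epsilon> * (y - t)) \<and> (y \<le> t \<longrightarrow> \<phi> t - \<phi> y \<le> \<epsilon> * (t - y))"
    if t: "t \<in> {a..b} - N" for t
  proof -
    obtain v where v: "v \<le> 0" "(\<phi> has_vector_derivative v) (at t within {a..b})"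
      using deriv[OF t] by blast
    then obtain d where d: "d > 0" "\<And>y. y \<in> {a..b} \<Longrightarrow> \<bar>y - t\<bar> < d \<Longrightarrow>
        \<bar>\<phi> y - \<phi> t - (y - t) * v\<bar> \<le> \<epsilon> * \<bar>y - t\<bar>"
      unfolding has_vector_derivative_def has_derivative_within_alt real_norm_def real_scaleR_def
      using \<epsilon> by meson
    have "(t \<le> y \<longrightarrow> \<phi> y - \<phi> t \<le> \<epsilon> * (y - t)) \<and> (y \<le> t \<longrightarrow> \<phi> t - \<phi> y \<le> \<epsilon> * (t - y))"
      if y: "y \<in> {a..b}" "\<bar>y - t\<bar> < d" for y
    proof (intro conjI impI)
      assume "t \<le> y"
      then have "(y - t) * v \<le> 0" using v(1) by (simp add: mult_le_0_iff)
      then show "\<phi> y - \<phi> t \<le> \<epsilon> * (y - t)" using d(2)[OF y] \<open>t \<le> y\<close> by simp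
    next
      assume "y \<le> t"
      then have "(y - t) * v \<ge> 0" using v(1) by (simp add: zero_le_mult_iff)
      then show "\<phi> t - \<phi> y \<le> \<epsilon> * (t - y)" using d(2)[OF y] \<open>y \<le> t\<close> by (simp add: abs_if split: if_splits)
    qed
    then show ?thesis using d(1) by blast
  qed
  then obtain d where d: "\<And>t. t \<in> {a..b} - N \<Longrightarrow> d t > 0"
    and dd: "\<And>t y. t \<in> {a..b} - N \<Longrightarrow> y \<in> {a..b} \<Longrightarrow> \<bar>y - t\<bar> < d t \<Longrightarrow>
      (t \<le> y \<longrightarrow> \<phi> y - \<phi> t \<le> \<epsilon> * (y - t)) \<and> (y \<le> t \<longrightarrow> \<phi> t - \<phi> y \<le> \<epsilon> * (t - y))"
    by metis
  define \<gamma> where "\<gamma> t = (if t \<in> N then U else if t \<in> {a..b} then ball t (d t) else UNIV)" for t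
  have "gauge \<gamma>"
    unfolding gauge_def \<gamma>_def using U d by auto
  then obtain p where p: "p tagged_division_of {a..b}" "\<gamma> fine p"
    using fine_division_exists_real by blast
  have pD: "\<exists>u v. u \<le> v \<and> K = {u..v} \<and> x \<in> {u..v} \<and> {u..v} \<subseteq> {a..b} \<and> {u..v} \<subseteq> \<gamma> x"
    if "(x, K) \<in> p" for x K
    using tagged_division_ofD(2-4)[OF p(1) that] fineD[OF p(2) that]
    by (metis atLeastAtMost_iff box_real(2) order_trans)
  have finp: "finite p" using p(1) by blast
  define p1 where "p1 = {(x, K) \<in> p. x \<in> N}"
  have p1p: "p1 \<subseteq> p" by (auto simp: p1_def)
  have p1: "p1 tagged_partial_division_of {a..b}"
    using tagged_partial_division_subset[of p "{a..b}" p1] p(1) p1p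
    by (simp add: tagged_division_of_def)
  have div1: "(snd ` p1) division_of \<Union>(snd ` p1)"
    using partial_division_of_tagged_division[OF p1] .
  have sub1: "\<Union>(snd ` p1) \<subseteq> {a..b}" "\<Union>(snd ` p1) \<subseteq> U"
    using pD p1p unfolding p1_def \<gamma>_def by fastforce+
  have "(\<Sum>K\<in>snd ` p1. Sup K - Inf K) = (\<Sum>K\<in>snd ` p1. measure lebesgue K)"
    using p1p pD by (intro sum.cong) fastforce+
  also have "\<dots> = measure lebesgue (\<Union>(snd ` p1))"
    using content_division[OF div1] by simp
  also have "\<dots> \<le> measure lebesgue U"
    using sub1(2) U_meas(1) div1 by (intro measure_mono_fmeasurable) (auto intro: lmeasurable_division fmeasurableD)
  also have "\<dots> < \<delta>" by (rule U_meas(2))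
  finally have "(\<Sum>K\<in>snd ` p1. norm (\<phi> (Sup K) - \<phi> (Inf K))) < \<epsilon>"
    using ac\<delta>[OF div1 sub1(1)] by blast
  moreover have "(\<Sum>(x, K)\<in>p1. norm (\<phi> (Sup K) - \<phi> (Inf K)))
      = (\<Sum>K\<in>snd ` p1. norm (\<phi> (Sup K) - \<phi> (Inf K)))"
  proof -
    \<comment> \<open>Several tags may carry the same degenerate interval, so re-indexing the sum by
      intervals requires a weight that vanishes there. The value at \<open>{}\<close> is fixed by
      hand because \<open>Inf\<close> and \<open>Sup\<close> mean nothing on it.\<close>
    define w where "w K = (if K = {} then 0 else norm (\<phi> (Sup K) - \<phi> (Inf K)))" for K
    have w: "w K = norm (\<phi> (Sup K) - \<phi> (Inf K))" if "(x, K) \<in> p1" for x K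
      using pD[of x K] that p1p by (auto simp: w_def)
    have "(\<Sum>(x, K)\<in>p1. w K) = (\<Sum>K\<in>snd ` p1. w K)"
    proof (rule sum.over_tagged_division_lemma[OF tagged_partial_division_of_Union_self[OF p1]])
      fix u v :: real assume "box u v = {}"
      then show "w (cbox u v) = 0" by (cases "u = v") (auto simp: w_def)
    qed
    moreover have "(\<Sum>(x, K)\<in>p1. w K) = (\<Sum>(x, K)\<in>p1. norm (\<phi> (Sup K) - \<phi> (Inf K)))"
      using w by (intro sum.cong) auto
    moreover have "(\<Sum>K\<in>snd ` p1. w K) = (\<Sum>K\<in>snd ` p1. norm (\<phi> (Sup K) - \<phi> (Inf K)))"
      using w by (intro sum.cong) auto
    ultimately show ?thesis by simp
  qed
  moreover have "(\<Sum>(x, K)\<in>p1. \<phi> (Sup K) - \<phi> (Inf K)) \<le> (\<Sum>(x, K)\<in>p1. norm (\<phi> (Sup K) - \<phi> (Inf K)))"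
    by (intro sum_mono) auto
  ultimately have sum1: "(\<Sum>(x, K)\<in>p1. \<phi> (Sup K) - \<phi> (Inf K)) \<le> \<epsilon>" by simp
  have "(\<Sum>(x, K)\<in>p - p1. \<phi> (Sup K) - \<phi> (Inf K)) \<le> (\<Sum>(x, K)\<in>p - p1. \<epsilon> * (Sup K - Inf K))"
  proof (intro sum_mono, clarify)
    fix x K assume xK: "(x, K) \<in> p" "(x, K) \<notin> p1"
    obtain u v where uv: "u \<le> v" "K = {u..v}" "x \<in> {u..v}" "{u..v} \<subseteq> {a..b}" "{u..v} \<subseteq> \<gamma> x"
      using pD[OF xK(1)] by blast
    have x: "x \<in> {a..b} - N" using xK uv by (auto simp: p1_def)
    then have "u \<in> ball x (d x)" "v \<in> ball x (d x)" using uv(1,5) by (auto simp: \<gamma>_def)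
    then have "\<phi> v - \<phi> x \<le> \<epsilon> * (v - x)" "\<phi> x - \<phi> u \<le> \<epsilon> * (x - u)"
      using dd[OF x, of v] dd[OF x, of u] uv by (auto simp: dist_real_def)
    then show "\<phi> (Sup K) - \<phi> (Inf K) \<le> \<epsilon> * (Sup K - Inf K)"
      using uv(1,2) by (simp add: algebra_simps)
  qed
  also have "\<dots> \<le> (\<Sum>(x, K)\<in>p. \<epsilon> * (Sup K - Inf K))"
    using finp pD \<epsilon> by (intro sum_mono2) fastforce+
  also have "\<dots> = \<epsilon> * (b - a)"
    using additive_tagged_division_1[OF ab p(1), of "\<lambda>x. \<epsilon> * x"] by (simp add: right_diff_distrib)
  finally have sum2: "(\<Sum>(x, K)\<in>p - p1. \<phi> (Sup K) - \<phi> (Inf K)) \<le> \<epsilon> * (b - a)" .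
  have "\<phi> b - \<phi> a = (\<Sum>(x, K)\<in>p. \<phi> (Sup K) - \<phi> (Inf K))"
    using additive_tagged_division_1[OF ab p(1), of \<phi>] by simp
  also have "\<dots> = (\<Sum>(x, K)\<in>p - p1. \<phi> (Sup K) - \<phi> (Inf K)) + (\<Sum>(x, K)\<in>p1. \<phi> (Sup K) - \<phi> (Inf K))"
    by (rule sum.subset_diff[OF p1p finp])
  also have "\<dots> \<le> \<epsilon> * (b - a) + \<epsilon>" using sum1 sum2 by simp
  also have "\<dots> = \<epsilon> * (b - a + 1)" by (simp add: distrib_left)
  also have "\<dots> = e" using ab by (simp add: \<epsilon>_def)
  finally show "\<phi> b \<le> \<phi> a + e" by simp
qed

text \<open>Shaped for the weighted squared distance of two solutions, whose increments are
  controlled by those of both solutions and, through the weight, of time.\<close>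

lemma absolutely_continuous_dominated:
  assumes x: "absolutely_continuous_on S x" and y: "absolutely_continuous_on S y" and K: "K > 0"
    and le: "\<And>s t. s \<in> S \<Longrightarrow> t \<in> S \<Longrightarrow>
      norm (\<phi> t - \<phi> s) \<le> K * (norm (x t - x s) + norm (y t - y s) + \<bar>t - s\<bar>)"
  shows "absolutely_continuous_on S \<phi>"
  unfolding absolutely_continuous_on_def
proof (intro allI impI)
  fix e :: real assume e: "e > 0"
  define \<epsilon> where "\<epsilon> = e / (3 * K)"
  have \<epsilon>: "\<epsilon> > 0" using e K by (simp add: \<epsilon>_def)
  obtain \<delta>1 where \<delta>1: "\<delta>1 > 0" "\<And>D. D division_of \<Union>D \<Longrightarrow> \<Union>D \<subseteq> S \<Longrightarrow>
      (\<Sum>K\<in>D. Sup K - Inf K) < \<delta>1 \<Longrightarrow> (\<Sum>K\<in>D. norm (x (Sup K) - x (Inf K))) < \<epsilon>"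
    using x \<epsilon> unfolding absolutely_continuous_on_def by meson
  obtain \<delta>2 where \<delta>2: "\<delta>2 > 0" "\<And>D. D division_of \<Union>D \<Longrightarrow> \<Union>D \<subseteq> S \<Longrightarrow>
      (\<Sum>K\<in>D. Sup K - Inf K) < \<delta>2 \<Longrightarrow> (\<Sum>K\<in>D. norm (y (Sup K) - y (Inf K))) < \<epsilon>"
    using y \<epsilon> unfolding absolutely_continuous_on_def by meson
  show "\<exists>\<delta>>0. \<forall>D. D division_of \<Union>D \<and> \<Union>D \<subseteq> S \<and> (\<Sum>K\<in>D. Sup K - Inf K) < \<delta>
      \<longrightarrow> (\<Sum>K\<in>D. norm (\<phi> (Sup K) - \<phi> (Inf K))) < e"
  \<comment> \<open>The bound by \<open>\<epsilon>\<close> itself serves the third summand, the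
    total length of the intervals.\<close>
  proof (rule exI[of _ "min \<epsilon> (min \<delta>1 \<delta>2)"], intro conjI allI impI)
    show "min \<epsilon> (min \<delta>1 \<delta>2) > 0" using \<epsilon> \<delta>1 \<delta>2 by simp
    fix D :: "real set set"
    assume D: "D division_of \<Union>D \<and> \<Union>D \<subseteq> S \<and> (\<Sum>K\<in>D. Sup K - Inf K) < min \<epsilon> (min \<delta>1 \<delta>2)"
    have DK: "Inf J \<in> S \<and> Sup J \<in> S \<and> Inf J \<le> Sup J" if J: "J \<in> D" for J
    proof -
      obtain u v where "J = {u..v}" "u \<le> v"
        using division_ofD(3,4)[OF conjunct1[OF D] J] by (metis atLeastatMost_empty_iff2 box_real(2))
      moreover have "J \<subseteq> S" using D J by blast
      ultimately show ?thesis by auto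
    qed
    have "(\<Sum>J\<in>D. norm (\<phi> (Sup J) - \<phi> (Inf J))) \<le>
        (\<Sum>J\<in>D. K * (norm (x (Sup J) - x (Inf J)) + norm (y (Sup J) - y (Inf J)) + (Sup J - Inf J)))"
      using DK by (intro sum_mono) (metis abs_of_nonneg diff_ge_0_iff_ge le)
    also have "\<dots> = K * ((\<Sum>J\<in>D. norm (x (Sup J) - x (Inf J)))
        + (\<Sum>J\<in>D. norm (y (Sup J) - y (Inf J))) + (\<Sum>J\<in>D. Sup J - Inf J))"
      by (simp only: sum.distrib sum_distrib_left[symmetric])
    also have "\<dots> < K * (\<epsilon> + \<epsilon> + \<epsilon>)"
      using D \<delta>1(2)[of D] \<delta>2(2)[of D] K by (intro mult_strict_left_mono) auto
    also have "\<dots> = e" using K by (simp add: \<epsilon>_def)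
    finally show "(\<Sum>J\<in>D. norm (\<phi> (Sup J) - \<phi> (Inf J))) < e" .
  qed
qed

lemma absolutely_continuous_on_const: "absolutely_continuous_on S (\<lambda>t. c)"
  unfolding absolutely_continuous_on_def by (auto intro: exI[of _ 1])

lemma lipschitz_imp_absolutely_continuous:
  assumes "R-lipschitz_on S x"
  shows "absolutely_continuous_on S x"
proof (rule absolutely_continuous_dominated[of S "\<lambda>t. 0::real" "\<lambda>t. 0::real" "R + 1"])
  have R: "R \<ge> 0" using assms by (rule lipschitz_on_nonneg)
  show "R + 1 > 0" using R by simp
  fix s t assume st: "s \<in> S" "t \<in> S"
  have "norm (x t - x s) \<le> R * \<bar>t - s\<bar>"
    using lipschitz_onD[OF assms st(2,1)] by (simp add: dist_norm)
  also have "\<dots> \<le> (R + 1) * \<bar>t - s\<bar>" by (intro mult_right_mono) auto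
  finally show "norm (x t - x s) \<le> (R + 1) * (norm (0 - 0::real) + norm (0 - 0::real) + \<bar>t - s\<bar>)" by simp
qed (rule absolutely_continuous_on_const)+

lemma absolutely_continuous_imp_continuous:
  fixes x :: "real \<Rightarrow> 'a::real_normed_vector"
  assumes "absolutely_continuous_on {a..b} x"
  shows "continuous_on {a..b} x"
  unfolding continuous_on_iff
proof (intro ballI allI impI)
  fix t e :: real assume t: "t \<in> {a..b}" and e: "e > 0"
  obtain \<delta> where \<delta>: "\<delta> > 0" "\<And>D. D division_of \<Union>D \<Longrightarrow> \<Union>D \<subseteq> {a..b} \<Longrightarrow>
      (\<Sum>K\<in>D. Sup K - Inf K) < \<delta> \<Longrightarrow> (\<Sum>K\<in>D. norm (x (Sup K) - x (Inf K))) < e"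
    using assms e unfolding absolutely_continuous_on_def by meson
  have *: "norm (x v - x u) < e" if "u \<le> v" "u \<in> {a..b}" "v \<in> {a..b}" "v - u < \<delta>" for u v
    using \<delta>(2)[of "{{u..v}}"] that division_of_self[of u v] by simp
  show "\<exists>d>0. \<forall>s\<in>{a..b}. dist s t < d \<longrightarrow> dist (x s) (x t) < e"
  proof (intro exI[of _ \<delta>] conjI ballI impI)
    fix s assume "s \<in> {a..b}" "dist s t < \<delta>"
    then show "dist (x s) (x t) < e"
      using *[of s t] *[of t s] t by (cases "s \<le> t") (auto simp: dist_norm norm_minus_commute)
  qed (rule \<delta>(1))
qed

section \<open>Differentiability of Lipschitz functions\<close>

text \<open>A pair \<open>(u, v)\<close> stands for the interval, which is the closed ball about its
  midpoint, so Vitali's theorem for balls applies. An interval offered at \<open>x\<close> may have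
  \<open>x\<close> as an endpoint, which admits difference quotients from either side.\<close>

lemma vitali_intervals:
  fixes S U :: "real set" and P :: "real \<Rightarrow> real \<Rightarrow> bool"
  assumes U: "open U" "S \<subseteq> U"
    and fine: "\<And>x d. x \<in> S \<Longrightarrow> d > 0 \<Longrightarrow> \<exists>u v. u < v \<and> x \<in> {u..v} \<and> v - u < d \<and> P u v"
  obtains C where "countable C"
    "\<And>i. i \<in> C \<Longrightarrow> fst i < snd i \<and> {fst i..snd i} \<subseteq> U \<and> P (fst i) (snd i)"
    "disjoint_family_on (\<lambda>i. {fst i..snd i}) C"
    "negligible (S - (\<Union>i\<in>C. {fst i..snd i}))"
proof -
  let ?K = "{i. fst i < snd i \<and> {fst i..snd i} \<subseteq> U \<and> P (fst i) (snd i)}"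
  let ?a = "\<lambda>i. (fst i + snd i) / (2::real)" and ?r = "\<lambda>i. (snd i - fst i) / (2::real)"
  have ball: "cball (?a i) (?r i) = {fst i..snd i}" for i
    by (simp add: cball_eq_atLeastAtMost field_simps)
  have "\<exists>i. i \<in> ?K \<and> x \<in> cball (?a i) (?r i) \<and> ?r i < d" if x: "x \<in> S" and d: "0 < d" for x d
  proof -
    obtain e where e: "e > 0" "ball x e \<subseteq> U" using U x by (meson openE subsetD)
    obtain u v where uv: "u < v" "x \<in> {u..v}" "v - u < min e d" "P u v"
      using fine[OF x, of "min e d"] e d by auto
    have "{u..v} \<subseteq> ball x e" using uv by (auto simp: dist_real_def)
    moreover have "cball ((u + v) / 2) ((v - u) / 2) = {u..v}"
      by (simp add: cball_eq_atLeastAtMost field_simps)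
    ultimately show ?thesis
      using uv e d by (intro exI[of _ "(u, v)"]) (auto simp del: mem_cball)
  qed
  from Vitali_covering_theorem_cballs[of ?K ?r S ?a, OF _ this]
  obtain C where C: "countable C" "C \<subseteq> ?K"
    "pairwise (\<lambda>i j. disjnt (cball (?a i) (?r i)) (cball (?a j) (?r j))) C"
    "negligible (S - (\<Union>i\<in>C. cball (?a i) (?r i)))"
    by (auto simp del: mem_cball)
  have "disjoint_family_on (\<lambda>i. {fst i..snd i}) C"
    using C(3) unfolding ball disjoint_family_on_def pairwise_def disjnt_def by blast
  then show ?thesis using C that[of C] unfolding ball by blast
qed

text \<open>
  Comparing \<open>\<nu> = dg\<close> with Lebesgue measure: cover \<open>S\<close> by intervals of slope below \<open>p\<close>, then cover
  it again, inside these, by intervals of slope above \<open>q\<close>.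
\<close>

lemma slopes_measure_step:
  fixes g :: "real \<Rightarrow> real"
  assumes mono: "\<And>x y. x \<le> y \<Longrightarrow> g x \<le> g y" and cont: "continuous_on UNIV g"
    and p: "0 \<le> p" and q: "0 \<le> q"
    and U: "open U" "S \<subseteq> U"
    and below: "\<And>x d. x \<in> S \<Longrightarrow> d > 0 \<Longrightarrow>
      \<exists>u v. u < v \<and> x \<in> {u..v} \<and> v - u < d \<and> g v - g u \<le> p * (v - u)"
    and above: "\<And>x d. x \<in> S \<Longrightarrow> d > 0 \<Longrightarrow>
      \<exists>u v. u < v \<and> x \<in> {u..v} \<and> v - u < d \<and> q * (v - u) \<le> g v - g u"
  obtains V where "V \<in> sets borel" "negligible (S - V)"
    "ennreal q * emeasure lborel V \<le> ennreal p * emeasure lborel U"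
proof -
  let ?\<nu> = "interval_measure g"
  let ?I = "\<lambda>i::real \<times> real. {fst i..snd i}"
  \<comment> \<open>Continuity of \<open>g\<close> excludes atoms, so endpoints do not affect the
    \<open>\<nu>\<close>-measure.\<close>
  have Icc: "emeasure ?\<nu> (?I i) = ennreal (g (snd i) - g (fst i))"
    "emeasure lborel (?I i) = ennreal (snd i - fst i)" if "fst i < snd i" for i
    using emeasure_interval_measure_Icc[of "fst i" "snd i" g] mono cont that by auto
  obtain C where C: "countable C"
    "\<And>i. i \<in> C \<Longrightarrow> fst i < snd i \<and> ?I i \<subseteq> U \<and> g (snd i) - g (fst i) \<le> p * (snd i - fst i)"
    "disjoint_family_on ?I C" "negligible (S - (\<Union>i\<in>C. ?I i))"
    using vitali_intervals[OF U below] by blast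
  \<comment> \<open>Interiors give an open set in which the second cover can be chosen. Only the
    countably many endpoints are lost, and they are null.\<close>
  define W where "W = (\<Union>i\<in>C. {fst i<..<snd i})"
  have W: "open W" by (auto simp: W_def)
  obtain D where D: "countable D"
    "\<And>i. i \<in> D \<Longrightarrow> fst i < snd i \<and> ?I i \<subseteq> W \<and> q * (snd i - fst i) \<le> g (snd i) - g (fst i)"
    "disjoint_family_on ?I D" "negligible (S \<inter> W - (\<Union>i\<in>D. ?I i))"
    by (rule vitali_intervals[of W "S \<inter> W" "\<lambda>u v. q * (v - u) \<le> g v - g u"])
      (use W above in auto)
  define V where "V = (\<Union>i\<in>D. ?I i)"
  have meas: "emeasure M (\<Union>i\<in>E. ?I i) = (\<integral>\<^sup>+i. emeasure M (?I i) \<partial>count_space E)"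
    if "sets M = sets borel" "countable E" "disjoint_family_on ?I E" for M E
    using that by (intro emeasure_UN_countable) auto
  have "ennreal q * emeasure lborel V = (\<integral>\<^sup>+i. ennreal q * emeasure lborel (?I i) \<partial>count_space D)"
    unfolding V_def using meas[of lborel D] D(1,3) by (simp add: nn_integral_cmult)
  also have "\<dots> \<le> (\<integral>\<^sup>+i. emeasure ?\<nu> (?I i) \<partial>count_space D)"
  proof (rule nn_integral_mono)
    fix i assume "i \<in> space (count_space D)"
    then have i: "fst i < snd i" "q * (snd i - fst i) \<le> g (snd i) - g (fst i)" using D(2) by auto
    then show "ennreal q * emeasure lborel (?I i) \<le> emeasure ?\<nu> (?I i)"
      unfolding Icc[OF i(1)] using q i by (simp add: ennreal_leI flip: ennreal_mult)
  qed
  also have "\<dots> = emeasure ?\<nu> V"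
    unfolding V_def using meas[of ?\<nu> D] D(1,3) by simp
  also have "\<dots> \<le> emeasure ?\<nu> (\<Union>i\<in>C. ?I i)"
  proof (rule emeasure_mono)
    have "V \<subseteq> W" using D(2) by (auto simp: V_def)
    also have "W \<subseteq> (\<Union>i\<in>C. ?I i)" unfolding W_def by (intro UN_mono) auto
    finally show "V \<subseteq> (\<Union>i\<in>C. ?I i)" .
    show "(\<Union>i\<in>C. ?I i) \<in> sets ?\<nu>" using C(1) by (auto intro: sets.countable_UN')
  qed
  also have "\<dots> = (\<integral>\<^sup>+i. emeasure ?\<nu> (?I i) \<partial>count_space C)"
    using meas[of ?\<nu> C] C(1,3) by simp
  also have "\<dots> \<le> (\<integral>\<^sup>+i. ennreal p * emeasure lborel (?I i) \<partial>count_space C)"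
  proof (rule nn_integral_mono)
    fix i assume "i \<in> space (count_space C)"
    then have i: "fst i < snd i" "g (snd i) - g (fst i) \<le> p * (snd i - fst i)" using C(2) by auto
    then show "emeasure ?\<nu> (?I i) \<le> ennreal p * emeasure lborel (?I i)"
      unfolding Icc[OF i(1)] using p i by (simp add: ennreal_leI flip: ennreal_mult)
  qed
  also have "\<dots> = ennreal p * emeasure lborel (\<Union>i\<in>C. ?I i)"
    using meas[of lborel C] C(1,3) by (simp add: nn_integral_cmult)
  also have "\<dots> \<le> ennreal p * emeasure lborel U"
    using C(2) U(1) by (intro mult_left_mono emeasure_mono) auto
  finally have "ennreal q * emeasure lborel V \<le> ennreal p * emeasure lborel U" .
  moreover have "V \<in> sets borel" unfolding V_def using D(1) by (auto intro: sets.countable_UN')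
  moreover have "negligible (S - V)"
  proof (rule negligible_subset)
    let ?E = "fst ` C \<union> snd ` C"
    have "negligible (\<Union>x\<in>?E. {x})"
      using C(1) by (intro negligible_countable_Union) auto
    then have "negligible ?E" by simp
    then show "negligible ((S \<inter> W - V) \<union> (S - (\<Union>i\<in>C. ?I i)) \<union> ?E)"
      using D(4) C(4) unfolding V_def by (intro negligible_Un) auto
    show "S - V \<subseteq> (S \<inter> W - V) \<union> (S - (\<Union>i\<in>C. ?I i)) \<union> ?E"
      unfolding W_def by (fastforce simp: less_le)
  qed
  ultimately show thesis using that by blast
qed

text \<open>Each use of \<open>slopes_measure_step\<close> shrinks an open cover of \<open>S\<close>
  by a factor close to \<open>p / q < 1\<close>, up to a null set. Iteration gives covers of
  arbitrarily small measure.\<close>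

lemma slopes_bounded_negligible:
  fixes g :: "real \<Rightarrow> real"
  assumes mono: "\<And>x y. x \<le> y \<Longrightarrow> g x \<le> g y" and cont: "continuous_on UNIV g"
    and pq: "0 \<le> p" "p < q"
    and bdd: "S \<subseteq> box a b"
    and below: "\<And>x d. x \<in> S \<Longrightarrow> d > 0 \<Longrightarrow>
      \<exists>u v. u < v \<and> x \<in> {u..v} \<and> v - u < d \<and> g v - g u \<le> p * (v - u)"
    and above: "\<And>x d. x \<in> S \<Longrightarrow> d > 0 \<Longrightarrow>
      \<exists>u v. u < v \<and> x \<in> {u..v} \<and> v - u < d \<and> q * (v - u) \<le> g v - g u"
  shows "negligible S"
proof -
  \<comment> \<open>The midpoint between \<open>p / q\<close> and 1: the gap above
    \<open>p / q\<close> is spent on making the new cover open, the gap below 1 keeps the iteration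
    contracting.\<close>
  define \<theta> where "\<theta> = (p + q) / (2 * q)"
  have \<theta>: "0 < \<theta>" "\<theta> < 1" "p / q < \<theta>" using pq by (auto simp: \<theta>_def field_simps)
  define m where "m = measure lborel (box a b) + 1"
  have m: "m > 0" unfolding m_def by (simp add: add_nonneg_pos)
  have step: "\<exists>U. open U \<and> S \<subseteq> U \<and> emeasure lborel U \<le> ennreal (\<theta> ^ n * m)" for n
  proof (induction n)
    case 0
    have "emeasure lborel (box a b) \<le> ennreal m"
      using emeasure_lborel_box_finite[of a b]
      by (subst emeasure_eq_ennreal_measure) (auto simp: m_def simp del: emeasure_lborel_box_eq intro!: ennreal_leI)
    then show ?case using bdd by (intro exI[of _ "box a b"]) auto
  next
    case (Suc n)
    let ?b = "\<theta> ^ n * m"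
    have b: "?b > 0" using \<theta> m by simp
    obtain U where U: "open U" "S \<subseteq> U" "emeasure lborel U \<le> ennreal ?b" using Suc by blast
    obtain V where V: "V \<in> sets borel" "negligible (S - V)"
      "ennreal q * emeasure lborel V \<le> ennreal p * emeasure lborel U"
      using slopes_measure_step[OF mono cont pq(1) _ U(1,2) below above] pq by auto
    have "ennreal q * emeasure lborel V \<le> ennreal p * ennreal ?b"
      using V(3) U(3) by (meson mult_left_mono order_trans zero_le)
    also have "\<dots> = ennreal q * ennreal (p / q * ?b)"
      using pq b by (simp flip: ennreal_mult)
    finally have "emeasure lborel V \<le> ennreal (p / q * ?b)"
      using pq by (subst (asm) ennreal_mult_le_mult_iff) auto
    \<comment> \<open>Adding the null remainder \<open>S - V\<close> gives a measurable set that
      contains \<open>S\<close> and has the measure of \<open>V\<close>; its open enlargement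
      restarts the iteration.\<close>
    moreover have "emeasure lebesgue (V \<union> (S - V)) = emeasure lebesgue V"
      using V(1,2) by (intro emeasure_Un_null_set) (simp_all add: negligible_iff_null_sets)
    ultimately have Vle: "emeasure lebesgue (V \<union> (S - V)) \<le> ennreal (p / q * ?b)"
      using V(1) by simp
    have "V \<union> (S - V) \<in> sets lebesgue"
      using V(1,2) by (intro sets.Un) (simp_all add: negligible_imp_sets)
    moreover have "(\<theta> - p / q) * ?b > 0" using \<theta>(3) by (intro mult_pos_pos b) simp
    ultimately obtain W where W: "open W" "V \<union> (S - V) \<subseteq> W"
      "emeasure lebesgue (W - (V \<union> (S - V))) < ennreal ((\<theta> - p / q) * ?b)"
      "W - (V \<union> (S - V)) \<in> lmeasurable"
      using sets_lebesgue_outer_open by metis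
    have "emeasure lborel W = emeasure lebesgue ((V \<union> (S - V)) \<union> (W - (V \<union> (S - V))))"
      using W(1,2) by (simp add: Un_absorb1)
    also have "\<dots> \<le> emeasure lebesgue (V \<union> (S - V)) + emeasure lebesgue (W - (V \<union> (S - V)))"
      using W(4) \<open>V \<union> (S - V) \<in> sets lebesgue\<close> by (intro emeasure_subadditive) auto
    also have "\<dots> \<le> ennreal (p / q * ?b) + ennreal ((\<theta> - p / q) * ?b)"
      using Vle W(3) by (intro add_mono) auto
    also have "\<dots> = ennreal (p / q * ?b + (\<theta> - p / q) * ?b)"
    proof (rule ennreal_plus[symmetric])
      show "0 \<le> p / q * ?b" using pq \<theta> m by simp
    qed (use \<open>(\<theta> - p / q) * ?b > 0\<close> in simp)
    also have "p / q * ?b + (\<theta> - p / q) * ?b = \<theta> ^ Suc n * m" by (simp add: algebra_simps)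
    finally show ?case using W(1,2) by blast
  qed
  show ?thesis unfolding negligible_outer_le
  proof (intro allI impI)
    fix e :: real assume "e > 0"
    have "(\<lambda>n. \<theta> ^ n * m) \<longlonglongrightarrow> 0 * m"
      using \<theta> by (intro tendsto_mult tendsto_const LIMSEQ_power_zero) auto
    then have "\<forall>\<^sub>F n in sequentially. \<theta> ^ n * m < e"
      using \<open>e > 0\<close> by (intro order_tendstoD(2)) auto
    then obtain n where n: "\<theta> ^ n * m < e" by (meson eventually_sequentially order_refl)
    obtain U where U: "open U" "S \<subseteq> U" "emeasure lborel U \<le> ennreal (\<theta> ^ n * m)"
      using step by blast
    then have "U \<in> lmeasurable"
      by (intro fmeasurableI) (auto intro: le_less_trans)
    moreover have "measure lebesgue U \<le> e"
    proof -
      have "ennreal (measure lebesgue U) = emeasure lebesgue U"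
        by (rule emeasure_eq_measure2[OF \<open>U \<in> lmeasurable\<close>, symmetric])
      also have "\<dots> = emeasure lborel U" using U(1) by simp
      also note U(3)
      finally show ?thesis using n \<theta> m by (simp add: ennreal_le_iff)
    qed
    ultimately show "\<exists>T. S \<subseteq> T \<and> T \<in> lmeasurable \<and> measure lebesgue T \<le> e"
      using U(2) by blast
  qed
qed

text \<open>If the lower and upper limits differ, two rationals fit strictly between them and both
  are crossed frequently. Rationality keeps the exceptional sets countable in number; boundedness
  makes the common limit finite.\<close>

lemma bounded_convergent_or_oscillates:
  fixes Q :: "'a \<Rightarrow> real"
  assumes F: "F \<noteq> bot" and Q: "\<forall>\<^sub>F h in F. Q h \<in> {c..B}"
    and osc: "\<And>p q :: rat. p < q \<Longrightarrow>
      \<not> ((\<exists>\<^sub>F h in F. Q h < of_rat p) \<and> (\<exists>\<^sub>F h in F. Q h > of_rat q))"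
  shows "\<exists>l. (Q \<longlongrightarrow> l) F"
proof -
  let ?Q = "\<lambda>h. ereal (Q h)"
  have le: "ereal c \<le> Liminf F ?Q" "Limsup F ?Q \<le> ereal B"
    using Q by (auto intro!: Liminf_bounded Limsup_bounded elim: eventually_mono)
  have LL: "Liminf F ?Q \<le> Limsup F ?Q" by (rule Liminf_le_Limsup[OF F])
  have "Liminf F ?Q = Limsup F ?Q"
  proof (rule ccontr)
    assume "\<not> ?thesis"
    then have "Liminf F ?Q < Limsup F ?Q" using LL by simp
    then obtain p :: rat where p: "Liminf F ?Q < real_of_rat p" "real_of_rat p < Limsup F ?Q"
      using ereal_dense3 by blast
    obtain q :: rat where q: "real_of_rat p < ereal (real_of_rat q)" "real_of_rat q < Limsup F ?Q"
      using ereal_dense3[OF p(2)] by blast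
    have "\<exists>\<^sub>F h in F. Q h < of_rat p"
    proof (rule ccontr)
      assume "\<not> ?thesis"
      then have "\<forall>\<^sub>F h in F. ereal (of_rat p) \<le> ?Q h"
        by (simp add: frequently_def not_less)
      from Liminf_bounded[OF this] p(1) show False by simp
    qed
    moreover have "\<exists>\<^sub>F h in F. Q h > of_rat q"
    proof (rule ccontr)
      assume "\<not> ?thesis"
      then have "\<forall>\<^sub>F h in F. ?Q h \<le> ereal (of_rat q)"
        by (simp add: frequently_def not_less)
      from Limsup_bounded[OF this] q(2) show False by simp
    qed
    moreover have "p < q" using q(1) by (simp add: of_rat_less)
    ultimately show False using osc by blast
  qed
  moreover from this le obtain l where "Limsup F ?Q = ereal l"
    by (metis ereal_infty_less_eq(1,2) ereal_cases PInfty_neq_ereal(1) MInfty_neq_ereal(1))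
  ultimately have l: "Liminf F ?Q = ereal l" "Limsup F ?Q = ereal l" by auto
  have "(?Q \<longlongrightarrow> ereal l) F" using F l tendsto_iff_Liminf_eq_Limsup[of F ?Q "ereal l"] by blast
  then show ?thesis by auto
qed

text \<open>Where \<open>g\<close> is not differentiable, its difference quotients, confined to
  \<open>{0..B}\<close>, fall frequently below \<open>p\<close> and rise frequently above
  \<open>q\<close> for some rationals \<open>p < q\<close>. Cut down to bounded boxes, these are
  countably many sets, each null by the slope comparison.\<close>

lemma lipschitz_mono_differentiable_ae:
  fixes g :: "real \<Rightarrow> real"
  assumes mono: "\<And>x y. x \<le> y \<Longrightarrow> g x \<le> g y" and lip: "B-lipschitz_on UNIV g"
  shows "negligible {x. \<not> g differentiable (at x)}"
proof -
  have cont: "continuous_on UNIV g" by (rule lipschitz_on_continuous_on[OF lip])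
  define Q where "Q x h = (g (x + h) - g x) / h" for x h
  define S where "S a p q = {x \<in> box (-a) a. (\<exists>\<^sub>F h in at 0. Q x h < p) \<and> (\<exists>\<^sub>F h in at 0. Q x h > q)}"
    for a p q :: real
  have Qrange: "Q x h \<in> {0..B}" if "h \<noteq> 0" for x h
  proof -
    have "\<bar>g (x + h) - g x\<bar> \<le> B * \<bar>h\<bar>"
      using lipschitz_onD[OF lip, of "x + h" x] by (simp add: dist_real_def)
    moreover have "Q x h \<ge> 0"
      using mono[of x "x + h"] mono[of "x + h" x] that unfolding Q_def
      by (cases "h > 0") (auto simp: divide_nonneg_pos divide_nonpos_neg)
    moreover have "\<bar>Q x h\<bar> = \<bar>g (x + h) - g x\<bar> / \<bar>h\<bar>" by (simp add: Q_def)
    ultimately show ?thesis using that by (simp add: pos_divide_le_eq abs_of_nonneg)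
  qed
  have neg: "negligible (S a p q)" if pq: "p < q" for a p q
  proof (cases "0 \<le> p")
    case True
    have interval: "\<exists>u v. u < v \<and> x \<in> {u..v} \<and> v - u < d \<and> R ((g v - g u) / (v - u))"
      if "\<exists>\<^sub>F h in at 0. R (Q x h)" "d > 0" for R x d
    proof -
      have "\<exists>h\<in>UNIV. h \<noteq> 0 \<and> dist h 0 < d \<and> R (Q x h)"
        using that unfolding frequently_at by blast
      then obtain h where h: "h \<noteq> 0" "\<bar>h\<bar> < d" "R (Q x h)" by auto
      show ?thesis
      proof (cases "h > 0")
        case True
        then show ?thesis using h by (intro exI[of _ x] exI[of _ "x + h"]) (auto simp: Q_def)
      next
        case False
        have "(g x - g (x + h)) / - h = Q x h" by (simp add: Q_def divide_simps)
        then show ?thesis using False h by (intro exI[of _ "x + h"] exI[of _ x]) auto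
      qed
    qed
    show ?thesis
    proof (rule slopes_bounded_negligible[OF mono cont True pq, of _ "-a" a])
      show "S a p q \<subseteq> box (-a) a" by (auto simp: S_def)
      fix x d :: real assume x: "x \<in> S a p q" and d: "d > 0"
      show "\<exists>u v. u < v \<and> x \<in> {u..v} \<and> v - u < d \<and> g v - g u \<le> p * (v - u)"
        using interval[of "\<lambda>s. s < p" x d] x d unfolding S_def
        by (force simp: pos_divide_less_eq)
      show "\<exists>u v. u < v \<and> x \<in> {u..v} \<and> v - u < d \<and> q * (v - u) \<le> g v - g u"
        using interval[of "\<lambda>s. s > q" x d] x d unfolding S_def
        by (force simp: pos_less_divide_eq)
    qed
  next
    case False
    have "\<not> (\<exists>\<^sub>F h in at 0. Q x h < p)" for x
      unfolding frequently_def eventually_at not_not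
      using Qrange[of _ x] False by (intro exI[of _ 1]) force
    then show ?thesis by (simp add: S_def)
  qed
  have "{x. \<not> g differentiable (at x)} \<subseteq>
      (\<Union>(n, p, q)\<in>{(n::nat, p::rat, q::rat). p < q}. S (real n) (of_rat p) (of_rat q))"
  proof
    fix x assume x: "x \<in> {x. \<not> g differentiable (at x)}"
    have "\<nexists>l. (Q x \<longlongrightarrow> l) (at 0)"
      using x unfolding Q_def
      by (auto simp: DERIV_def[symmetric] real_differentiable_def)
    moreover have "\<forall>\<^sub>F h in at 0. Q x h \<in> {0..B}"
      using Qrange unfolding eventually_at by (intro exI[of _ 1]) auto
    ultimately obtain p q :: rat where "p < q"
      "\<exists>\<^sub>F h in at 0. Q x h < of_rat p" "\<exists>\<^sub>F h in at 0. Q x h > of_rat q"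
      using bounded_convergent_or_oscillates[of "at 0" "Q x" 0 B] by auto
    moreover obtain n :: nat where "\<bar>x\<bar> < real n" using reals_Archimedean2 by blast
    ultimately show "x \<in> (\<Union>(n, p, q)\<in>{(n::nat, p::rat, q::rat). p < q}. S (real n) (of_rat p) (of_rat q))"
      by (intro UN_I[of "(n, p, q)"]) (auto simp: S_def)
  qed
  moreover have "negligible (\<Union>(n, p, q)\<in>{(n::nat, p::rat, q::rat). p < q}. S (real n) (of_rat p) (of_rat q))"
    using neg by (intro negligible_countable_Union) (auto simp: of_rat_less)
  ultimately show ?thesis by (rule negligible_subset[rotated])
qed

text \<open>Adding \<open>B * t\<close> to a component of a \<open>B\<close>-Lipschitz function
  makes it nondecreasing without affecting differentiability, so the monotone case applies to each
  coordinate.\<close>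

lemma lipschitz_differentiable_ae:
  fixes x :: "real \<Rightarrow> 'a::euclidean_space"
  assumes lip: "B-lipschitz_on {a..b} x"
  shows "negligible {t \<in> {a<..<b}. \<not> x differentiable (at t)}"
proof (cases "a \<le> b")
  case True
  have B: "B \<ge> 0" using lip by (rule lipschitz_on_nonneg)
  \<comment> \<open>Clamping time to the interval extends \<open>x\<close> to the line with the same
    Lipschitz constant and changes nothing near interior points.\<close>
  define c where "c t = max a (min b t)" for t
  have c: "c t \<in> {a..b}" "\<bar>c t - c s\<bar> \<le> \<bar>t - s\<bar>" for s t using True by (auto simp: c_def)
  define X where "X i t = x (c t) \<bullet> i" for i t
  define N where "N = (\<Union>i\<in>Basis. {t. \<not> (\<lambda>t. X i t + B * t) differentiable (at t)})"
  have "negligible {t. \<not> (\<lambda>t. X i t + B * t) differentiable (at t)}" if i: "i \<in> Basis" for i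
  proof (rule lipschitz_mono_differentiable_ae)
    have X: "\<bar>X i t - X i s\<bar> \<le> B * \<bar>t - s\<bar>" for s t
    proof -
      have "\<bar>X i t - X i s\<bar> \<le> norm (x (c t) - x (c s))"
        unfolding X_def inner_diff_left[symmetric] by (rule Basis_le_norm[OF i])
      also have "\<dots> \<le> B * \<bar>c t - c s\<bar>"
        using lipschitz_onD[OF lip c(1) c(1)] by (simp add: dist_norm)
      also have "\<dots> \<le> B * \<bar>t - s\<bar>" using B c(2) by (rule mult_left_mono[rotated])
      finally show ?thesis .
    qed
    show "X i s + B * s \<le> X i t + B * t" if "s \<le> t" for s t
      using X[of s t] that by (simp add: algebra_simps)
    show "(2 * B)-lipschitz_on UNIV (\<lambda>t. X i t + B * t)"
    proof (rule lipschitz_onI)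
      fix s t :: real
      have "\<bar>X i s + B * s - (X i t + B * t)\<bar> \<le> \<bar>X i s - X i t\<bar> + \<bar>B * (s - t)\<bar>"
        by (simp add: algebra_simps)
      also have "\<dots> \<le> B * \<bar>s - t\<bar> + B * \<bar>s - t\<bar>"
        using X[of s t] B by (simp add: abs_mult)
      finally show "dist (X i s + B * s) (X i t + B * t) \<le> 2 * B * dist s t"
        by (simp add: dist_real_def)
    qed (use B in simp)
  qed
  then have "negligible N" unfolding N_def by (intro negligible_Union) auto
  moreover have "{t \<in> {a<..<b}. \<not> x differentiable (at t)} \<subseteq> N"
  proof clarify
    fix t assume t: "t \<in> {a<..<b}" "\<not> x differentiable (at t)"
    show "t \<in> N"
    proof (rule ccontr)
      assume "t \<notin> N"
      have comp: "(\<lambda>t. x t \<bullet> i) differentiable (at t)" if i: "i \<in> Basis" for i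
      proof -
        have "(\<lambda>t. X i t + B * t) differentiable (at t)" using \<open>t \<notin> N\<close> i by (auto simp: N_def)
        then have "(\<lambda>t. (X i t + B * t) - B * t) differentiable (at t)"
          by (rule differentiable_diff) (intro derivative_intros)
        then have "X i differentiable (at t)" by simp
        then obtain D where D: "(X i has_derivative D) (at t)" by (auto simp: differentiable_def)
        have "((\<lambda>t. x t \<bullet> i) has_derivative D) (at t)"
          by (rule has_derivative_transform_within_open[OF D, of "{a<..<b}"])
            (use t(1) in \<open>auto simp: X_def c_def\<close>)
        then show ?thesis by (auto simp: differentiable_def)
      qed
      then have "x differentiable (at t)"
        by (subst differentiable_componentwise_within) blast
      with t(2) show False by simp
    qed
  qed
  ultimately show ?thesis by (rule negligible_subset)
qed auto

lemma AE_lebesgue_on_iff_negligible: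
  assumes S: "S \<in> sets lebesgue"
  shows "(AE t in lebesgue_on S. P t) \<longleftrightarrow> negligible {t \<in> S. \<not> P t}"
proof
  assume "AE t in lebesgue_on S. P t"
  then obtain N where N: "N \<in> null_sets (lebesgue_on S)" "{t \<in> space (lebesgue_on S). \<not> P t} \<subseteq> N"
    unfolding eventually_ae_filter by blast
  then have "negligible N"
    using S by (simp add: null_sets_restrict_space negligible_iff_null_sets)
  then show "negligible {t \<in> S. \<not> P t}"
    using N(2) by (auto intro: negligible_subset simp: space_restrict_space)
next
  assume "negligible {t \<in> S. \<not> P t}"
  then have "{t \<in> S. \<not> P t} \<in> null_sets (lebesgue_on S)"
    using S by (auto simp: null_sets_restrict_space negligible_iff_null_sets)
  then show "AE t in lebesgue_on S. P t"
    by (rule AE_I') (auto simp: space_restrict_space)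
qed

section \<open>Existence by implicit time discretisation\<close>

text \<open>The parameter counts steps: node \<open>i\<close> sits at \<open>r = i\<close>, and time
  enters later as \<open>(t - t0) / h\<close>.\<close>

definition polygon :: "(nat \<Rightarrow> 'a::real_vector) \<Rightarrow> real \<Rightarrow> 'a" where
  "polygon x r = x (nat \<lfloor>r\<rfloor>) + (r - real (nat \<lfloor>r\<rfloor>)) *\<^sub>R (x (Suc (nat \<lfloor>r\<rfloor>)) - x (nat \<lfloor>r\<rfloor>))"

lemma polygon_of_nat [simp]: "polygon x (real i) = x i"
  by (simp add: polygon_def)

text \<open>A one-sided bound in a single direction \<open>c\<close> is what a tested monotonicity
  inequality provides. The slope hypothesis concerns the segments \<open>[i, i + 1)\<close> that
  meet \<open>[s, r]\<close>.\<close>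

lemma polygon_inner_le:
  fixes x :: "nat \<Rightarrow> 'a::real_inner"
  assumes s: "0 \<le> s" "s \<le> r"
    and slope: "\<And>i. real i \<le> r \<Longrightarrow> s < real i + 1 \<Longrightarrow> (x (Suc i) - x i) \<bullet> c \<le> m"
  shows "(polygon x r - polygon x s) \<bullet> c \<le> m * (r - s)"
proof -
  define a b where "a = nat \<lfloor>s\<rfloor>" and "b = nat \<lfloor>r\<rfloor>"
  define D where "D i = (x (Suc i) - x i) \<bullet> c" for i
  have a: "real a \<le> s" "s < real a + 1" and b: "real b \<le> r" "r < real b + 1"
    using s unfolding a_def b_def by linarith+
  have ab: "a \<le> b" using s unfolding a_def b_def by (intro nat_mono floor_mono)
  have slope': "D i \<le> m" if "a \<le> i" "i \<le> b" for i
    unfolding D_def using that a b by (intro slope) auto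
  have P: "polygon x s \<bullet> c = x a \<bullet> c + (s - a) * D a" "polygon x r \<bullet> c = x b \<bullet> c + (r - b) * D b"
    unfolding polygon_def D_def a_def b_def by (simp_all add: inner_add_left)
  show ?thesis
  proof (cases "a = b")
    case True
    then have "(polygon x r - polygon x s) \<bullet> c = (r - s) * D a"
      using P by (simp add: inner_diff_left algebra_simps)
    also have "\<dots> \<le> (r - s) * m" using s slope'[of a] ab by (intro mult_left_mono) auto
    finally show ?thesis by (simp add: mult.commute)
  next
    case False
    then have "Suc a \<le> b" using ab by simp
    then have "x b \<bullet> c - x (Suc a) \<bullet> c \<le> m * (real b - real (Suc a))"
    proof (rule dec_induct[where P = "\<lambda>j. j \<le> b \<longrightarrow> x j \<bullet> c - x (Suc a) \<bullet> c \<le> m * (real j - real (Suc a))", THEN mp])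
      fix j assume j: "Suc a \<le> j" "j \<le> b \<longrightarrow> x j \<bullet> c - x (Suc a) \<bullet> c \<le> m * (real j - real (Suc a))"
      show "Suc j \<le> b \<longrightarrow> x (Suc j) \<bullet> c - x (Suc a) \<bullet> c \<le> m * (real (Suc j) - real (Suc a))"
      proof
        assume "Suc j \<le> b"
        then show "x (Suc j) \<bullet> c - x (Suc a) \<bullet> c \<le> m * (real (Suc j) - real (Suc a))"
          using j slope'[of j] by (simp add: D_def inner_diff_left algebra_simps)
      qed
    qed auto
    moreover have "(r - b) * D b \<le> (r - b) * m"
      using b slope'[of b] ab by (intro mult_left_mono) auto
    \<comment> \<open>The part of the first segment after \<open>s\<close> has length
      \<open>1 - (s - a)\<close>, the part of the last before \<open>r\<close> has length
      \<open>r - b\<close>; whole segments in between telescope.\<close>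
    moreover have "(1 - (s - a)) * D a \<le> (1 - (s - a)) * m"
      using a slope'[of a] ab by (intro mult_left_mono) auto
    moreover have "x (Suc a) \<bullet> c = x a \<bullet> c + D a" by (simp add: D_def inner_diff_left)
    ultimately show ?thesis using P by (simp add: inner_diff_left algebra_simps)
  qed
qed

text \<open>The directional bound is applied with the increment itself as direction, after which one
  factor of its norm cancels.\<close>

lemma polygon_lipschitz:
  fixes x :: "nat \<Rightarrow> 'a::real_inner"
  assumes s: "0 \<le> s" "s \<le> b" "0 \<le> r" "r \<le> b"
    and slope: "\<And>i. real i \<le> b \<Longrightarrow> norm (x (Suc i) - x i) \<le> m"
  shows "norm (polygon x r - polygon x s) \<le> m * \<bar>r - s\<bar>"
proof -
  have *: "norm (polygon x r - polygon x s) \<le> m * (r - s)" if "0 \<le> s" "s \<le> r" "r \<le> b" for r s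
  proof -
    let ?c = "polygon x r - polygon x s"
    have "?c \<bullet> ?c \<le> (m * norm ?c) * (r - s)"
    proof (rule polygon_inner_le[OF that(1,2)])
      fix i assume "real i \<le> r"
      then have "norm (x (Suc i) - x i) \<le> m" using that by (intro slope) simp
      then have "norm (x (Suc i) - x i) * norm ?c \<le> m * norm ?c" by (rule mult_right_mono) simp
      then show "(x (Suc i) - x i) \<bullet> ?c \<le> m * norm ?c"
        using norm_cauchy_schwarz order_trans by blast
    qed
    then have "norm ?c * norm ?c \<le> norm ?c * (m * (r - s))"
      by (simp add: dot_square_norm power2_eq_square mult_ac)
    moreover have "m * (r - s) \<ge> 0"
      using slope[of 0] that by (intro mult_nonneg_nonneg) (auto intro: order_trans[OF norm_ge_zero])
    ultimately show ?thesis by (cases "norm ?c = 0") (auto simp: mult_le_cancel_left)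
  qed
  show ?thesis
    using *[of s r] *[of r s] s by (cases "s \<le> r") (auto simp: norm_minus_commute)
qed

text \<open>
  \<open>K\<close> is so large that \<open>(1 - L2) * K * B\<close> absorbs every term of the quadratic inequality but \<open>L2 * s\<close>.
\<close>

lemma velocity_bound:
  fixes L1 L2 c K B a r s :: real
  assumes L: "0 \<le> L1" "0 \<le> L2" "L2 < 1" and c: "0 \<le> c"
    and K: "K = 1 + (c + L1 + (L1 + 1) * (1 + c)) / (1 - L2)"
    and B: "1 \<le> B" and a: "a \<le> c * B" and r: "0 \<le> r" and s: "s \<le> K * B"
    and quad: "r * r \<le> a * r + (L1 + L2 * s) * (1 + a + r)" and pos: "0 \<le> a" "0 \<le> s"
  shows "r \<le> K * B"
proof (rule ccontr)
  assume "\<not> r \<le> K * B"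
  then have rKB: "K * B < r" by simp
  have q: "(c + L1 + (L1 + 1) * (1 + c)) / (1 - L2) \<ge> 0" using L c by simp
  have K1: "1 \<le> K" using q unfolding K by simp
  have K2: "c + L1 + (L1 + 1) * (1 + c) \<le> (1 - L2) * K"
  proof -
    have "Q \<le> (1 - L2) * (1 + Q / (1 - L2))" for Q using L by (simp add: distrib_left)
    then show ?thesis unfolding K .
  qed
  have KB: "B \<le> K * B" using mult_right_mono[OF K1, of B] B by simp
  \<comment> \<open>Because \<open>r > 1\<close>, the terms free of \<open>r\<close> may be
    multiplied by \<open>r\<close>, and then \<open>r\<close> divides the whole inequality.\<close>
  have r1: "1 < r" using KB B rKB by linarith
  have "(L1 + L2 * s) * (1 + a + r) \<le> (L1 + L2 * (K * B)) * ((1 + c) * B + r)"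
  proof (intro mult_mono add_mono mult_left_mono)
    show "1 + a \<le> (1 + c) * B" using B a by (simp add: distrib_right)
    show "0 \<le> L1 + L2 * (K * B)" using L K1 B by (intro add_nonneg_nonneg mult_nonneg_nonneg) auto
  qed (use L s pos r in auto)
  moreover have "L1 * ((1 + c) * B) \<le> L1 * ((1 + c) * B) * r"
    using L c B r1 by (intro mult_left_mono[of 1 r, simplified]) auto
  moreover have "L2 * (K * B) * ((1 + c) * B) \<le> L2 * r * ((1 + c) * B)"
    using L c B rKB by (intro mult_right_mono mult_left_mono) auto
  moreover have "a * r \<le> c * B * r" using a r by (rule mult_right_mono)
  ultimately have "r * r \<le> (c * B + L1 * ((1 + c) * B) + L2 * ((1 + c) * B) + L1 + L2 * (K * B)) * r"
    using quad by (simp add: algebra_simps)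
  then have "r \<le> c * B + L1 * ((1 + c) * B) + L2 * ((1 + c) * B) + L1 + L2 * (K * B)"
    using r1 by simp
  also have "\<dots> \<le> c * B + L1 * ((1 + c) * B) + 1 * ((1 + c) * B) + L1 * B + L2 * (K * B)"
    using L c B KB mult_left_mono[OF B L(1)] by (intro add_mono mult_right_mono) auto
  also have "\<dots> = (c + L1 + (L1 + 1) * (1 + c)) * B + L2 * (K * B)" by (simp add: algebra_simps)
  also have "\<dots> \<le> (1 - L2) * K * B + L2 * (K * B)"
    using K2 B by (intro add_right_mono mult_right_mono) auto
  also have "\<dots> = K * B" by (simp add: algebra_simps)
  finally show False using rKB by simp
qed

section \<open>The implicit scheme and its limit\<close>

locale operator_family =
  fixes A :: "real \<Rightarrow> 'a::euclidean_space \<Rightarrow> 'a \<Rightarrow> 'a set" and f :: "real \<Rightarrow> 'a \<Rightarrow> 'a"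
    and L1 L2 cA cf :: real
  assumes maximal: "maximal_monotone (A t x)"
    and L1: "0 \<le> L1" and L2: "0 \<le> L2" "L2 < 1" and cA: "0 \<le> cA" and cf: "0 \<le> cf"
    and dis: "\<eta> \<in> A t x u \<Longrightarrow> \<zeta> \<in> A s y v \<Longrightarrow>
      (\<eta> - \<zeta>) \<bullet> (v - u) \<le> (L1 * \<bar>t - s\<bar> + L2 * norm (x - y)) * (1 + norm \<eta> + norm \<zeta>)"
    and small_value: "y \<in> op_dom (A t x) \<Longrightarrow> \<exists>\<eta>\<in>A t x y. norm \<eta> \<le> cA * (1 + norm x + norm y)"
    and f_cont: "continuous_on UNIV (\<lambda>(t, x). f t x)"
    and f_growth: "norm (f t x) \<le> cf * (1 + norm x)"
begin

primrec scheme :: "real \<Rightarrow> real \<Rightarrow> 'a \<Rightarrow> nat \<Rightarrow> 'a" where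
  "scheme h t0 x0 0 = x0"
| "scheme h t0 x0 (Suc i) = (SOME y. (scheme h t0 x0 i + h *\<^sub>R f (t0 + real i * h) (scheme h t0 x0 i) - y) /\<^sub>R h
      \<in> A (t0 + real (Suc i) * h) (scheme h t0 x0 i) y)"

lemma scheme_inclusion:
  assumes "h > 0"
  shows "f (t0 + real i * h) (scheme h t0 x0 i) - (scheme h t0 x0 (Suc i) - scheme h t0 x0 i) /\<^sub>R h
    \<in> A (t0 + real (Suc i) * h) (scheme h t0 x0 i) (scheme h t0 x0 (Suc i))"
proof -
  let ?x = "scheme h t0 x0 i" and ?y = "scheme h t0 x0 (Suc i)"
  let ?f = "f (t0 + real i * h) ?x"
  have "(?x + h *\<^sub>R ?f - ?y) /\<^sub>R h \<in> A (t0 + real (Suc i) * h) ?x ?y"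
    unfolding scheme.simps by (rule someI_ex) (rule resolvent_exists[OF maximal assms])
  moreover have "(?x + h *\<^sub>R ?f - ?y) /\<^sub>R h = ?f - (?y - ?x) /\<^sub>R h"
    using assms by (simp add: algebra_simps)
  ultimately show ?thesis by simp
qed

text \<open>This is the \<open>K\<close> of \<open>velocity_bound\<close> for
  \<open>c = 2 * cA + cf\<close>. The factor 2 arises because the element at a node is bounded
  through the norms of two nodes.\<close>

definition speed :: real where
  "speed = 1 + ((2 * cA + cf) + L1 + (L1 + 1) * (1 + (2 * cA + cf))) / (1 - L2)"

lemma speed_ge_1: "1 \<le> speed"
  unfolding speed_def using L1 L2 cA cf by simp

text \<open>Size and velocity are bounded together: the velocity estimate needs the sizes of two
  nodes and the previous velocity, and its result feeds the next size. The majorant solves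
  \<open>B (Suc i) = (1 + h * speed) * B i\<close> with \<open>B 0 = 1 + norm x0\<close>.\<close>

lemma scheme_bound:
  assumes h: "h > 0" and x0: "x0 \<in> op_dom (A t0 x0)"
  shows "1 + norm (scheme h t0 x0 i) \<le> (1 + h * speed) ^ i * (1 + norm x0) \<and>
    norm (scheme h t0 x0 (Suc i) - scheme h t0 x0 i) \<le> h * speed * ((1 + h * speed) ^ i * (1 + norm x0))"
proof -
  let ?X = "scheme h t0 x0" and ?K = speed and ?c = "2 * cA + cf"
  define B where "B i = (1 + h * ?K) ^ i * (1 + norm x0)" for i
  have hK: "0 \<le> h * ?K" using h speed_ge_1 by simp
  have BSuc: "B (Suc i) = B i + h * ?K * B i" for i by (simp add: B_def algebra_simps)
  have B1: "1 \<le> B i" for i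
    unfolding B_def using mult_mono[of 1 "(1 + h * ?K) ^ i" 1 "1 + norm x0"] hK
    by (simp add: one_le_power)
  have BSuc_ge: "B i \<le> B (Suc i)" for i using B1[of i] hK by (simp add: BSuc)
  \<comment> \<open>at \<open>i = 0\<close> the truncated \<open>i - 1\<close> makes the predecessor of the initial node the node itself\<close>
  have step: "norm (?X (Suc i) - ?X i) \<le> h * ?K * B i"
    if IH: "1 + norm (?X i) \<le> B i" "1 + norm (?X (i - 1)) \<le> B i" "norm (?X i - ?X (i - 1)) \<le> h * ?K * B i"
    for i
  proof -
    let ?t = "t0 + real i * h"
    have "?X i \<in> op_dom (A ?t (?X (i - 1)))"
    proof (cases i)
      case 0 then show ?thesis using x0 by simp
    next
      case (Suc j) then show ?thesis
        using scheme_inclusion[OF h, of t0 j x0] unfolding op_dom_def by auto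
    qed
    then obtain \<eta> where \<eta>: "\<eta> \<in> A ?t (?X (i - 1)) (?X i)"
      "norm \<eta> \<le> cA * (1 + norm (?X (i - 1)) + norm (?X i))"
      using small_value by blast
    define w where "w = (?X (Suc i) - ?X i) /\<^sub>R h"
    let ?f = "f ?t (?X i)"
    have Xw: "?X i - ?X (Suc i) = - h *\<^sub>R w" using h by (simp add: w_def)
    have e: "?f - w \<in> A (t0 + real (Suc i) * h) (?X i) (?X (Suc i))"
      unfolding w_def by (rule scheme_inclusion[OF h])
    define \<sigma> where "\<sigma> = norm (?X i - ?X (i - 1)) / h"
    define a where "a = norm ?f + norm \<eta>"
    \<comment> \<open>The new element belongs to time \<open>?t + h\<close> and state
      \<open>?X i\<close>, \<open>\<eta>\<close> to time \<open>?t\<close> and state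
      \<open>?X (i - 1)\<close>, so the operators differ by at most
      \<open>h * (L1 + L2 * \<sigma>)\<close>, while the points differ by \<open>h * w\<close>.
      Cancelling \<open>h\<close> leaves the quadratic inequality for \<open>norm w\<close>.\<close>
    have "(?f - w - \<eta>) \<bullet> (- h *\<^sub>R w) \<le> (L1 * h + L2 * (h * \<sigma>)) * (1 + norm (?f - w) + norm \<eta>)"
      using dis[OF e \<eta>(1)] h unfolding Xw \<sigma>_def by (simp add: algebra_simps)
    then have "h * (w \<bullet> w - (?f - \<eta>) \<bullet> w) \<le> h * ((L1 + L2 * \<sigma>) * (1 + norm (?f - w) + norm \<eta>))"
      by (simp add: inner_diff_left algebra_simps)
    then have "w \<bullet> w - (?f - \<eta>) \<bullet> w \<le> (L1 + L2 * \<sigma>) * (1 + norm (?f - w) + norm \<eta>)"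
      using h by simp
    moreover have "(?f - \<eta>) \<bullet> w \<le> a * norm w"
      using norm_cauchy_schwarz[of "?f - \<eta>" w] norm_triangle_ineq4[of ?f \<eta>]
      by (smt (verit) a_def mult_right_mono norm_ge_zero)
    moreover have "(L1 + L2 * \<sigma>) * (1 + norm (?f - w) + norm \<eta>) \<le> (L1 + L2 * \<sigma>) * (1 + a + norm w)"
      using norm_triangle_ineq4[of ?f w] L1 L2 h
      by (intro mult_left_mono) (auto simp: a_def \<sigma>_def)
    ultimately have "norm w * norm w \<le> a * norm w + (L1 + L2 * \<sigma>) * (1 + a + norm w)"
      by (simp add: dot_square_norm power2_eq_square)
    moreover have "a \<le> ?c * B i"
    proof -
      have "norm ?f \<le> cf * B i" using f_growth[of ?t "?X i"] mult_left_mono[OF IH(1) cf] by linarith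
      moreover have "norm \<eta> \<le> cA * (2 * B i)"
        using \<eta>(2) mult_left_mono[of "1 + norm (?X (i - 1)) + norm (?X i)" "2 * B i" cA] IH cA by linarith
      ultimately show ?thesis by (simp add: a_def algebra_simps)
    qed
    moreover have "\<sigma> \<le> ?K * B i" using IH(3) h by (simp add: \<sigma>_def divide_le_eq mult_ac)
    ultimately have "norm w \<le> ?K * B i"
      using L1 L2 cA cf B1 h
      by (intro velocity_bound[OF _ _ _ _ speed_def, of "B i" a "norm w" \<sigma>]) (auto simp: a_def \<sigma>_def)
    then have "h * norm w \<le> h * (?K * B i)" using h by (intro mult_left_mono) auto
    moreover have "norm (?X (Suc i) - ?X i) = h * norm w"
      unfolding norm_minus_commute[of "?X (Suc i)"] Xw using h by simp
    ultimately show ?thesis by (simp only: mult.assoc)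
  qed
  have "1 + norm (?X i) \<le> B i \<and> 1 + norm (?X (i - 1)) \<le> B i \<and> norm (?X i - ?X (i - 1)) \<le> h * ?K * B i"
  proof (induction i)
    case 0
    then show ?case using hK by (simp add: B_def)
  next
    case (Suc i)
    have st: "norm (?X (Suc i) - ?X i) \<le> h * ?K * B i" using step Suc by blast
    moreover have "norm (?X (Suc i)) \<le> norm (?X i) + norm (?X (Suc i) - ?X i)"
      by (metis add.commute diff_add_cancel norm_triangle_ineq)
    moreover have "h * ?K * B i \<le> h * ?K * B (Suc i)" using BSuc_ge hK by (rule mult_left_mono)
    ultimately show ?case using Suc BSuc[of i] BSuc_ge[of i] by simp
  qed
  then show ?thesis using step unfolding B_def by blast
qed

text \<open>A discrete inclusion is tested against a fixed pair \<open>(u, \<eta>)\<close> of the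
  operator at \<open>(t, z)\<close>. The closing decomposition isolates
  \<open>(F - \<eta>) \<bullet> (z - u)\<close>; \<open>dis\<close> controls the change of operator,
  and the other terms pay for moving \<open>y\<close> to \<open>z\<close> and \<open>\<phi>\<close>
  to \<open>F\<close>.\<close>

lemma slope_estimate:
  assumes e: "\<phi> - w \<in> A s x y" and \<eta>: "\<eta> \<in> A t z u"
    and d: "\<bar>s - t\<bar> \<le> d" "norm (x - z) \<le> d" "norm (y - z) \<le> d"
    and R: "norm w \<le> R" and \<Phi>: "norm \<phi> \<le> \<Phi>" and F: "norm (\<phi> - F) \<le> \<epsilon>" and M: "norm y \<le> M"
  shows "w \<bullet> (z - u) \<le> (F - \<eta>) \<bullet> (z - u)
    + ((L1 + L2) * (1 + \<Phi> + R + norm \<eta>) + R + norm (F - \<eta>)) * d + \<epsilon> * (M + norm u)"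
proof -
  have d0: "0 \<le> d" using d by linarith
  have "(\<phi> - w - \<eta>) \<bullet> (u - y) \<le> (L1 * \<bar>s - t\<bar> + L2 * norm (x - z)) * (1 + norm (\<phi> - w) + norm \<eta>)"
    using dis[OF e \<eta>] .
  also have "\<dots> \<le> (L1 * d + L2 * d) * (1 + (\<Phi> + R) + norm \<eta>)"
  proof -
    have "norm (\<phi> - w) \<le> \<Phi> + R" using norm_triangle_ineq4[of \<phi> w] R \<Phi> by linarith
    then show ?thesis
      using d d0 L1 L2 by (intro mult_mono add_mono mult_left_mono add_nonneg_nonneg) auto
  qed
  finally have 1: "(\<phi> - w - \<eta>) \<bullet> (u - y) \<le> (L1 + L2) * (1 + \<Phi> + R + norm \<eta>) * d"
    by (simp add: algebra_simps)
  have 2: "w \<bullet> (z - y) \<le> R * d"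
    using norm_cauchy_schwarz[of w "z - y"] mult_mono[OF R d(3)] order_trans[OF norm_ge_zero R]
    by (simp add: norm_minus_commute)
  have 3: "(\<phi> - F) \<bullet> (y - u) \<le> \<epsilon> * (M + norm u)"
    using norm_cauchy_schwarz[of "\<phi> - F" "y - u"] norm_triangle_ineq4[of y u] M
      mult_mono[OF F, of "norm (y - u)" "M + norm u"] order_trans[OF norm_ge_zero F] by simp
  have 4: "(F - \<eta>) \<bullet> (y - z) \<le> norm (F - \<eta>) * d"
    using norm_cauchy_schwarz[of "F - \<eta>" "y - z"] mult_left_mono[OF d(3), of "norm (F - \<eta>)"] by simp
  have "w \<bullet> (z - u) = (\<phi> - w - \<eta>) \<bullet> (u - y) + w \<bullet> (z - y) + (\<phi> - F) \<bullet> (y - u)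
      + (F - \<eta>) \<bullet> (y - z) + (F - \<eta>) \<bullet> (z - u)"
    by (simp add: inner_diff_left inner_diff_right algebra_simps)
  then show ?thesis using 1 2 3 4 by (simp add: distrib_right)
qed


lemma solution_exists:
  assumes x0: "x0 \<in> op_dom (A t0 x0)" and t0T: "t0 \<le> T"
  shows "\<exists>x. is_solution A f T t0 x0 x"
proof -
  define L where "L = T - t0"
  define h where "h n = 1 / real (Suc n)" for n
  define X where "X n = scheme (h n) t0 x0" for n
  define P where "P n t = polygon (X n) ((t - t0) / h n)" for n t
  \<comment> \<open>The horizon is \<open>L + 1\<close> because a segment starting before
    \<open>T\<close> may end at a node beyond it, by at most one step
    \<open>h n \<le> 1\<close>.\<close>
  define M where "M = exp (speed * (L + 1)) * (1 + norm x0)"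
  define R where "R = speed * M"
  have L: "0 \<le> L" using t0T by (simp add: L_def)
  have h: "0 < h n" "h n \<le> 1" for n by (auto simp: h_def)
  have h0: "h \<longlonglongrightarrow> 0" unfolding h_def by (rule LIMSEQ_inverse_real_of_nat[unfolded inverse_eq_divide])
  have K: "1 \<le> speed" by (rule speed_ge_1)
  have bound: "1 + norm (X n i) \<le> M" "norm (X n (Suc i) - X n i) \<le> h n * R" if i: "real i * h n \<le> L + 1" for n i
  proof -
    have "(1 + h n * speed) ^ i \<le> exp (h n * speed) ^ i"
      using h[of n] K by (intro power_mono) (auto simp: exp_ge_add_one_self add_nonneg_nonneg)
    also have "\<dots> = exp (speed * (real i * h n))" by (simp add: exp_of_nat_mult[symmetric] mult_ac)
    also have "\<dots> \<le> exp (speed * (L + 1))" using i K by simp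
    finally have B: "(1 + h n * speed) ^ i * (1 + norm x0) \<le> M"
      unfolding M_def by (rule mult_right_mono) simp
    note sb = scheme_bound[OF h(1)[of n] x0, of i, folded X_def]
    show "1 + norm (X n i) \<le> M" using sb B by linarith
    have "norm (X n (Suc i) - X n i) \<le> h n * speed * ((1 + h n * speed) ^ i * (1 + norm x0))"
      using sb by blast
    also have "\<dots> \<le> h n * speed * M" using B h[of n] K by (intro mult_left_mono) auto
    finally show "norm (X n (Suc i) - X n i) \<le> h n * R" by (simp add: R_def mult.assoc)
  qed
  have M1: "1 \<le> M" using bound(1)[of 0 0] L by (simp add: order_trans[OF _ bound(1)[of 0 0]])
  have R0: "0 \<le> R" using M1 K by (simp add: R_def)
  have poly_lip: "norm (polygon (X n) r - polygon (X n) s) \<le> h n * R * \<bar>r - s\<bar>"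
    if "0 \<le> s" "s * h n \<le> L + 1" "0 \<le> r" "r * h n \<le> L + 1" for n r s
    by (rule polygon_lipschitz[of _ "(L + 1) / h n"])
      (use that h(1)[of n] bound(2)[of _ n] in \<open>auto simp: pos_le_divide_eq\<close>)
  have P_lip: "norm (P n t - P n s) \<le> R * \<bar>t - s\<bar>" if "s \<in> {t0..T}" "t \<in> {t0..T}" for n s t
  proof -
    have "norm (P n t - P n s) \<le> h n * R * \<bar>(t - t0) / h n - (s - t0) / h n\<bar>"
      unfolding P_def using that h(1)[of n] by (intro poly_lip) (auto simp: L_def)
    also have "(t - t0) / h n - (s - t0) / h n = (t - s) / h n"
      by (simp add: diff_divide_distrib)
    finally show ?thesis using h(1)[of n] by simp
  qed
  have P_t0: "P n t0 = x0" for n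
    using polygon_of_nat[of "X n" 0] by (simp add: P_def X_def)
  have P_bound: "norm (P n t) \<le> norm x0 + R * L" if t: "t \<in> {t0..T}" for n t
  proof -
    have "norm (P n t) \<le> norm (P n t0) + norm (P n t - P n t0)"
      by (metis add.commute diff_add_cancel norm_triangle_ineq)
    also have "norm (P n t - P n t0) \<le> R * \<bar>t - t0\<bar>" using t t0T by (intro P_lip) auto
    also have "R * \<bar>t - t0\<bar> \<le> R * L" using t R0 by (intro mult_left_mono) (auto simp: L_def)
    finally show ?thesis by (simp add: P_t0)
  qed
  obtain g k where k: "strict_mono (k :: nat \<Rightarrow> nat)"
    and unif: "\<And>e. 0 < e \<Longrightarrow> \<exists>N. \<forall>n t. n \<ge> N \<and> t \<in> {t0..T} \<longrightarrow> norm (P (k n) t - g t) < e"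
  proof (rule Arzela_Ascoli[of "{t0..T}" P "norm x0 + R * L"])
    fix t e :: real assume t: "t \<in> {t0..T}" and e: "0 < e"
    show "\<exists>d. 0 < d \<and> (\<forall>n s. s \<in> {t0..T} \<and> norm (t - s) < d \<longrightarrow> norm (P n t - P n s) < e)"
    proof (intro exI[of _ "e / (R + 1)"] conjI allI impI)
      show "0 < e / (R + 1)" using e R0 by simp
      fix n s assume s: "s \<in> {t0..T} \<and> norm (t - s) < e / (R + 1)"
      have "norm (P n t - P n s) \<le> R * \<bar>t - s\<bar>" using s t by (intro P_lip) auto
      also have "\<dots> \<le> (R + 1) * \<bar>t - s\<bar>" by (intro mult_right_mono) auto
      also have "\<dots> < e" using s R0 by (simp add: pos_less_divide_eq mult.commute)
      finally show "norm (P n t - P n s) < e" .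
    qed
  qed (use P_bound in auto)
  have lim: "(\<lambda>n. P (k n) t) \<longlonglongrightarrow> g t" if "t \<in> {t0..T}" for t
    unfolding LIMSEQ_iff using unif that by blast
  have hk0: "(\<lambda>n. h (k n)) \<longlonglongrightarrow> 0"
    using LIMSEQ_subseq_LIMSEQ[OF h0 k] by (simp add: o_def)
  have g_lip: "R-lipschitz_on {t0..T} g"
  proof (rule lipschitz_onI)
    fix t s assume ts: "t \<in> {t0..T}" "s \<in> {t0..T}"
    have "(\<lambda>n. norm (P (k n) t - P (k n) s)) \<longlonglongrightarrow> norm (g t - g s)"
      using lim ts by (intro tendsto_intros)
    then have "norm (g t - g s) \<le> R * \<bar>t - s\<bar>"
      by (rule tendsto_upperbound) (use P_lip ts in auto)
    then show "dist (g t) (g s) \<le> R * dist t s" by (simp add: dist_norm)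
  qed (rule R0)
  have g_t0: "g t0 = x0"
    using lim[of t0] t0T by (simp add: P_t0 LIMSEQ_const_iff)
  have increment: "\<exists>d>0. \<forall>\<delta>. 0 < \<delta> \<and> \<delta> < d \<and> t + \<delta> \<le> T \<longrightarrow>
      (g (t + \<delta>) - g t) \<bullet> (g t - u) \<le> ((f t (g t) - \<eta>) \<bullet> (g t - u) + \<epsilon>) * \<delta>"
    if t: "t \<in> {t0..<T}" and \<eta>: "\<eta> \<in> A t (g t) u" and \<epsilon>: "\<epsilon> > 0" for t u \<eta> \<epsilon>
  proof -
    let ?F = "f t (g t)" and ?c = "g t - u"
    let ?m = "(?F - \<eta>) \<bullet> ?c + \<epsilon>"
    \<comment> \<open>\<open>Z\<close> is the coefficient of \<open>d\<close> in
      \<open>slope_estimate\<close>. The choices of \<open>\<epsilon>1\<close> and \<open>d\<close>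
      below give each of the errors \<open>\<epsilon>1 * (M + norm u)\<close> and
      \<open>Z * d\<close> the share \<open>\<epsilon> / 2\<close>.\<close>
    define Z where "Z = (L1 + L2) * (1 + cf * M + R + norm \<eta>) + R + norm (?F - \<eta>)"
    have Z: "0 \<le> Z" unfolding Z_def using L1 L2 cf M1 R0 by simp
    define \<epsilon>1 where "\<epsilon>1 = \<epsilon> / (2 * (M + norm u))"
    have Mu: "0 < M + norm u" using M1 by (simp add: add_pos_nonneg)
    have \<epsilon>1: "\<epsilon>1 > 0" using \<epsilon> Mu by (simp add: \<epsilon>1_def)
    have "isCont (\<lambda>(t, x). f t x) (t, g t)"
      using f_cont by (simp add: continuous_on_eq_continuous_at)
    then obtain \<rho> where \<rho>: "\<rho> > 0" "\<And>q. dist q (t, g t) < \<rho> \<Longrightarrow> dist ((\<lambda>(t, x). f t x) q) ?F < \<epsilon>1"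
      unfolding continuous_at_eps_delta using \<epsilon>1 by (metis case_prod_conv)
    have f_near: "norm (f s y - ?F) \<le> \<epsilon>1" if "\<bar>s - t\<bar> < \<rho> / 2" "norm (y - g t) < \<rho> / 2" for s y
    proof -
      have "dist (s, y) (t, g t) \<le> dist s t + dist y (g t)"
        unfolding dist_Pair_Pair by (rule sqrt_sum_squares_le_sum) auto
      then show ?thesis using \<rho>(2)[of "(s, y)"] that by (simp add: dist_norm)
    qed
    define d where "d = min (\<rho> / 4) (\<epsilon> / (2 * (Z + 1)))"
    have d: "0 < d" "d < \<rho> / 2" using \<rho>(1) \<epsilon> Z by (auto simp: d_def min_less_iff_disj)
    have "Z * d \<le> (Z + 1) * (\<epsilon> / (2 * (Z + 1)))" using Z d(1) by (intro mult_mono) (auto simp: d_def)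
    also have "\<dots> = \<epsilon> / 2" using Z by (simp add: field_simps)
    finally have Zd: "Z * d \<le> \<epsilon> / 2" .
    have \<epsilon>1M: "\<epsilon>1 * (M + norm u) = \<epsilon> / 2" using Mu by (simp add: \<epsilon>1_def field_simps)
    \<comment> \<open>The increment \<open>\<delta>\<close> stays fixed while the step size tends to
      0. A node with time within \<open>\<delta> + H\<close> of \<open>t\<close> is within
      \<open>R * (\<delta> + H) < 2 * d / 3\<close> of the polygon at \<open>t\<close>, which is
      within \<open>d / 3\<close> of \<open>g t\<close>; hence the bound
      \<open>d / (3 * (R + 1))\<close> on both \<open>\<delta>\<close> and \<open>H\<close>.\<close>
    have "(g (t + \<delta>) - g t) \<bullet> ?c \<le> ?m * \<delta>"
      if \<delta>: "0 < \<delta>" "\<delta> < d / (3 * (R + 1))" "t + \<delta> \<le> T" for \<delta>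
    proof -
      have "d / (3 * (R + 1)) > 0" using d R0 by simp
      then have "\<forall>\<^sub>F n in sequentially. h (k n) < d / (3 * (R + 1))"
        using order_tendstoD(2)[OF hk0] by blast
      moreover have "\<forall>\<^sub>F n in sequentially. norm (P (k n) t - g t) < d / 3"
        using unif[of "d / 3"] d t unfolding eventually_sequentially by fastforce
      ultimately have "\<forall>\<^sub>F n in sequentially. (P (k n) (t + \<delta>) - P (k n) t) \<bullet> ?c \<le> ?m * \<delta>"
      proof eventually_elim
        case (elim n)
        define H where "H = h (k n)"
        have H: "0 < H" "H \<le> 1" "H < d / (3 * (R + 1))" using h elim by (auto simp: H_def)
        let ?Y = "X (k n)" and ?s = "(t - t0) / H" and ?r = "(t + \<delta> - t0) / H"
        have near: "norm (?Y i - g t) < d"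
          if i: "\<bar>t0 + real i * H - t\<bar> \<le> \<delta> + H" "real i * H \<le> L + 1" for i
        proof -
          have "norm (?Y i - P (k n) t) \<le> H * R * \<bar>real i - ?s\<bar>"
            using poly_lip[of ?s "k n" "real i"] i(2) t H L unfolding P_def H_def[symmetric]
            by (simp add: L_def)
          also have "H * R * \<bar>real i - ?s\<bar> = R * \<bar>H * (real i - ?s)\<bar>"
            using H by (simp add: abs_mult)
          also have "H * (real i - ?s) = t0 + real i * H - t"
            using H by (simp add: field_simps)
          also have "R * \<bar>t0 + real i * H - t\<bar> \<le> (R + 1) * (\<delta> + H)"
            using i(1) R0 by (intro mult_mono) auto
          also have "\<dots> < (R + 1) * (d / (3 * (R + 1)) + d / (3 * (R + 1)))"
            using \<delta> H R0 by (intro mult_strict_left_mono add_strict_mono) auto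
          also have "\<dots> = 2 * ((R + 1) * (d / (3 * (R + 1))))" by (simp only: distrib_left mult_2)
          also have "\<dots> = 2 * d / 3" using R0 by (simp add: field_simps)
          finally show ?thesis
            using elim(2) norm_triangle_ineq[of "?Y i - P (k n) t" "P (k n) t - g t"] by simp
        qed
        have \<delta>H: "\<delta> + H < d"
        proof -
          have "d / (3 * (R + 1)) \<le> d / 3" using d R0 by (intro divide_left_mono) auto
          then show ?thesis using \<delta>(2) H(3) d by linarith
        qed
        have "(polygon ?Y ?r - polygon ?Y ?s) \<bullet> ?c \<le> (H * ?m) * (?r - ?s)"
        proof (rule polygon_inner_le)
          show "0 \<le> ?s" "?s \<le> ?r" using t \<delta> H by (auto intro: divide_right_mono)
          fix i assume "real i \<le> ?r" "?s < real i + 1"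
          then have i: "t0 + real i * H \<le> t + \<delta>" "t < t0 + real i * H + H"
            using H by (auto simp: pos_le_divide_eq pos_divide_less_eq algebra_simps)
          have Si: "real (Suc i) * H = real i * H + H" by (simp add: algebra_simps)
          have iL: "real i * H \<le> L + 1" "real (Suc i) * H \<le> L + 1"
            using i \<delta> H unfolding Si by (auto simp: L_def)
          have xi: "norm (?Y i - g t) < d" using i \<delta> H iL by (intro near) auto
          have ySi: "norm (?Y (Suc i) - g t) < d"
          proof (rule near[OF _ iL(2)])
            show "\<bar>t0 + real (Suc i) * H - t\<bar> \<le> \<delta> + H" using i \<delta>(1) H(1) unfolding Si by linarith
          qed
          let ?w = "(?Y (Suc i) - ?Y i) /\<^sub>R H" and ?\<phi> = "f (t0 + real i * H) (?Y i)"
          have e: "?\<phi> - ?w \<in> A (t0 + real (Suc i) * H) (?Y i) (?Y (Suc i))"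
            unfolding X_def H_def by (rule scheme_inclusion[OF h(1)])
          have "norm ?w \<le> R"
            using bound(2)[of i "k n"] iL H unfolding H_def[symmetric]
            by (simp add: divide_simps mult.commute)
          moreover have "norm ?\<phi> \<le> cf * M"
            using f_growth[of "t0 + real i * H" "?Y i"] bound(1)[of i "k n"] iL cf
            unfolding H_def[symmetric] by (meson mult_left_mono order_trans)
          moreover have "norm (?\<phi> - ?F) \<le> \<epsilon>1"
          proof (rule f_near)
            show "\<bar>t0 + real i * H - t\<bar> < \<rho> / 2" using i \<delta>(1) H(1) \<delta>H d(2) by linarith
            show "norm (?Y i - g t) < \<rho> / 2" using xi d(2) by linarith
          qed
          moreover have "norm (?Y (Suc i)) \<le> M"
            using bound(1)[of "Suc i" "k n"] iL unfolding H_def[symmetric] by simp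
          moreover have "\<bar>t0 + real (Suc i) * H - t\<bar> \<le> d" using i \<delta>(1) H(1) \<delta>H unfolding Si by linarith
          ultimately have "?w \<bullet> ?c \<le> (?F - \<eta>) \<bullet> ?c + Z * d + \<epsilon>1 * (M + norm u)"
            unfolding Z_def using slope_estimate[OF e \<eta>, of d R "cf * M" ?F \<epsilon>1 M] xi ySi by simp
          then have "?w \<bullet> ?c \<le> ?m" using Zd \<epsilon>1M by simp
          then have "H * (?w \<bullet> ?c) \<le> H * ?m" using H by (intro mult_left_mono) auto
          moreover have "H * (?w \<bullet> ?c) = (?Y (Suc i) - ?Y i) \<bullet> ?c" using H(1) by simp
          ultimately show "(?Y (Suc i) - ?Y i) \<bullet> ?c \<le> H * ?m" by (simp only:)
        qed
        also have "(H * ?m) * (?r - ?s) = ?m * \<delta>"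
          using H by (simp add: diff_divide_distrib[symmetric])
        finally show ?case by (simp add: P_def H_def)
      qed
      moreover have "(\<lambda>n. (P (k n) (t + \<delta>) - P (k n) t) \<bullet> ?c) \<longlonglongrightarrow> (g (t + \<delta>) - g t) \<bullet> ?c"
        using lim[of t] lim[of "t + \<delta>"] t \<delta> by (intro tendsto_intros) auto
      ultimately show ?thesis
        using tendsto_upperbound[OF _ _ sequentially_bot] by blast
    qed
    then show ?thesis using d R0 by (intro exI[of _ "d / (3 * (R + 1))"]) auto
  qed
  have inclusion: "f t (g t) - v \<in> A t (g t) (g t)"
    if t: "t \<in> {t0<..<T}" and v: "(g has_vector_derivative v) (at t)" for t v
  proof (rule maximal_monotone_memI[OF maximal])
    fix u \<eta> assume \<eta>: "\<eta> \<in> A t (g t) u"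
    let ?c = "g t - u"
    have "v \<bullet> ?c \<le> (f t (g t) - \<eta>) \<bullet> ?c + \<epsilon>" if \<epsilon>: "\<epsilon> > 0" for \<epsilon>
    proof -
      obtain d where d: "d > 0" "\<And>\<delta>. 0 < \<delta> \<Longrightarrow> \<delta> < d \<Longrightarrow> t + \<delta> \<le> T \<Longrightarrow>
          (g (t + \<delta>) - g t) \<bullet> ?c \<le> ((f t (g t) - \<eta>) \<bullet> ?c + \<epsilon>) * \<delta>"
        using increment[of t \<eta> u \<epsilon>] t \<eta> \<epsilon> by auto
      have "((\<lambda>s. g s \<bullet> ?c) has_real_derivative v \<bullet> ?c) (at t)"
        unfolding has_real_derivative_iff_has_vector_derivative
        using bounded_linear.has_vector_derivative[OF bounded_linear_inner_left v] .
      \<comment> \<open>At a point of differentiability the right difference quotients already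
        determine \<open>v\<close>, so forward increments suffice.\<close>
      then have "((\<lambda>\<delta>. (g (t + \<delta>) \<bullet> ?c - g t \<bullet> ?c) / \<delta>) \<longlongrightarrow> v \<bullet> ?c) (at_right 0)"
        unfolding DERIV_def by (rule filterlim_mono) (auto simp: at_within_le_at)
      moreover have "\<forall>\<^sub>F \<delta> in at_right 0. (g (t + \<delta>) \<bullet> ?c - g t \<bullet> ?c) / \<delta> \<le> (f t (g t) - \<eta>) \<bullet> ?c + \<epsilon>"
        unfolding eventually_at_right_field
      proof (intro exI[of _ "min d (T - t)"] conjI allI impI)
        show "0 < min d (T - t)" using d t by simp
        fix \<delta> assume "0 < \<delta>" "\<delta> < min d (T - t)"
        then show "(g (t + \<delta>) \<bullet> ?c - g t \<bullet> ?c) / \<delta> \<le> (f t (g t) - \<eta>) \<bullet> ?c + \<epsilon>"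
          using d(2)[of \<delta>] by (simp add: inner_diff_left pos_divide_le_eq)
      qed
      ultimately show ?thesis by (rule tendsto_upperbound) simp
    qed
    then have "v \<bullet> ?c \<le> (f t (g t) - \<eta>) \<bullet> ?c" by (rule field_le_epsilon)
    then show "(\<eta> - (f t (g t) - v)) \<bullet> (u - g t) \<ge> 0"
      by (simp add: inner_diff_left inner_diff_right)
  qed
  have "is_solution A f T t0 x0 g"
    unfolding is_solution_def
  proof (intro conjI)
    show "absolutely_continuous_on {t0..T} g" by (rule lipschitz_imp_absolutely_continuous[OF g_lip])
    show "g t0 = x0" by (rule g_t0)
    let ?S = "\<lambda>t. \<exists>v. (g has_vector_derivative v) (at t within {t0..T}) \<and> v \<in> {f t (g t) - w |w. w \<in> A t (g t) (g t)}"
    \<comment> \<open>Differentiability was obtained two-sidedly in the open interval; the endpoints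
      join the null set.\<close>
    have "{t \<in> {t0..T}. \<not> ?S t} \<subseteq> {t \<in> {t0<..<T}. \<not> g differentiable (at t)} \<union> {t0, T}"
    proof (rule subsetI, rule UnCI)
      fix t assume "t \<in> {t \<in> {t0..T}. \<not> ?S t}" and "t \<notin> {t0, T}"
      then have t: "t \<in> {t0..T}" "t \<notin> {t0, T}" and nS: "\<not> ?S t" by auto
      have t': "t \<in> {t0<..<T}" using t by auto
      moreover have "\<not> g differentiable (at t)"
      proof
        assume "g differentiable (at t)"
        then obtain v where v: "(g has_vector_derivative v) (at t)"
          by (auto simp: vector_derivative_works)
        have "v = f t (g t) - (f t (g t) - v)" by simp
        then have "?S t"
          using inclusion[OF t' v] has_vector_derivative_at_within[OF v] by blast
        with nS show False by blast
      qed
      ultimately show "t \<in> {t \<in> {t0<..<T}. \<not> g differentiable (at t)}" by blast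
    qed
    moreover have "negligible ({t \<in> {t0<..<T}. \<not> g differentiable (at t)} \<union> {t0, T})"
      using lipschitz_differentiable_ae[OF g_lip] by (intro negligible_Un) auto
    ultimately have "negligible {t \<in> {t0..T}. \<not> ?S t}" by (rule negligible_subset[rotated])
    then show "AE t in lebesgue_on {t0..T}. ?S t"
      by (subst AE_lebesgue_on_iff_negligible) auto
  qed
  then show ?thesis by blast
qed

end

section \<open>Uniqueness\<close>

lemma exp_minus_diff_le:
  fixes a b :: real
  assumes "0 \<le> a" "0 \<le> b"
  shows "\<bar>exp (- a) - exp (- b)\<bar> \<le> \<bar>a - b\<bar>"
proof -
  have *: "exp (- a) - exp (- b) \<le> b - a" if "0 \<le> a" "a \<le> b" for a b :: real
  proof -
    have "exp (- a) - exp (- b) = exp (- a) * (1 - exp (a - b))"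
      by (simp add: right_diff_distrib flip: exp_add)
    also have "\<dots> \<le> 1 * (b - a)"
    proof (rule mult_mono)
      show "1 - exp (a - b) \<le> b - a" using exp_ge_add_one_self[of "a - b"] by linarith
    qed (use that in auto)
    finally show ?thesis by simp
  qed
  show ?thesis using *[of a b] *[of b a] assms by (cases "a \<le> b") (auto simp: abs_if)
qed

text \<open>Both trajectories are continuous, hence lie in a common ball, which supplies
  \<open>C\<close>. The integrating factor \<open>E\<close> turns Gronwall's inequality into
  monotonicity: \<open>\<phi>\<close> starts at 0 and has derivative \<open>2 * E s * ((v1 - v2)
  \<bullet> (x s - y s) - C * \<psi> s) \<le> 0\<close> outside a null set.\<close>

lemma solution_unique:
  fixes x y :: "real \<Rightarrow> 'a::euclidean_space"
  assumes x: "is_solution A f T t0 x0 x" and y: "is_solution A f T t0 x0 y"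
    and one_sided: "\<And>M::real. M > 0 \<Longrightarrow> \<exists>C>0. \<forall>t\<in>{t0..T}. \<forall>x1 x2. \<forall>w1\<in>A t x1 x1. \<forall>w2\<in>A t x2 x2.
      norm x1 \<le> M \<longrightarrow> norm x2 \<le> M \<longrightarrow>
        ((f t x1 - w1) - (f t x2 - w2)) \<bullet> (x1 - x2) \<le> C * (norm (x1 - x2))\<^sup>2"
    and t: "t \<in> {t0..T}"
  shows "x t = y t"
proof -
  have acx: "absolutely_continuous_on {t0..t} x" and acy: "absolutely_continuous_on {t0..t} y"
    using x y t unfolding is_solution_def by (auto intro: absolutely_continuous_on_subset)
  have "bounded (x ` {t0..t} \<union> y ` {t0..t})"
    using acx acy by (intro bounded_Un[THEN iffD2] conjI compact_imp_bounded compact_continuous_image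
        absolutely_continuous_imp_continuous) auto
  then obtain M where M: "M > 0" and Mxy: "\<And>s. s \<in> {t0..t} \<Longrightarrow> norm (x s) \<le> M \<and> norm (y s) \<le> M"
    unfolding bounded_pos by blast
  obtain C where C: "C > 0" and Cxy: "\<And>s x1 x2 w1 w2. s \<in> {t0..T} \<Longrightarrow> w1 \<in> A s x1 x1 \<Longrightarrow> w2 \<in> A s x2 x2 \<Longrightarrow>
      norm x1 \<le> M \<Longrightarrow> norm x2 \<le> M \<Longrightarrow>
      ((f s x1 - w1) - (f s x2 - w2)) \<bullet> (x1 - x2) \<le> C * (norm (x1 - x2))\<^sup>2"
    using one_sided[OF M] by blast
  define E where "E s = exp (- (2 * C * (s - t0)))" for s
  define \<psi> where "\<psi> s = (x s - y s) \<bullet> (x s - y s)" for s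
  define \<phi> where "\<phi> s = E s * \<psi> s" for s
  define N where "N = {s \<in> {t0..T}. \<not> (\<exists>v. (x has_vector_derivative v) (at s within {t0..T}) \<and>
            v \<in> {f s (x s) - w | w. w \<in> A s (x s) (x s)})} \<union>
      {s \<in> {t0..T}. \<not> (\<exists>v. (y has_vector_derivative v) (at s within {t0..T}) \<and>
            v \<in> {f s (y s) - w | w. w \<in> A s (y s) (y s)})}"
  have "negligible N"
    unfolding N_def using x y unfolding is_solution_def
    by (intro negligible_Un) (subst (asm) (1 2) AE_lebesgue_on_iff_negligible; simp)+
  have "absolutely_continuous_on {t0..t} \<phi>"
  proof (rule absolutely_continuous_dominated[OF acx acy, of "4 * M + 8 * C * M\<^sup>2"])
    \<comment> \<open>\<open>4 * M\<close> bounds the sum factor in the difference of two squares;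
      \<open>8 * C * M\<^sup>2\<close> is the Lipschitz constant \<open>2 * C\<close> of the weight
      times the bound \<open>(2 * M)\<^sup>2\<close> of \<open>\<psi>\<close>.\<close>
    show "0 < 4 * M + 8 * C * M\<^sup>2" using M C by (simp add: add_pos_nonneg)
    fix s r assume sr: "s \<in> {t0..t}" "r \<in> {t0..t}"
    let ?dx = "norm (x r - x s)" and ?dy = "norm (y r - y s)"
    have small: "norm (x q - y q) \<le> 2 * M" if "q \<in> {t0..t}" for q
      using Mxy[OF that] norm_triangle_ineq4[of "x q" "y q"] by linarith
    have "\<psi> r - \<psi> s = ((x r - y r) - (x s - y s)) \<bullet> ((x r - y r) + (x s - y s))"
      unfolding \<psi>_def by (simp add: inner_add_left inner_add_right inner_diff_left inner_diff_right
          inner_commute)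
    also have "\<bar>\<dots>\<bar> \<le> norm ((x r - y r) - (x s - y s)) * norm ((x r - y r) + (x s - y s))"
      by (rule Cauchy_Schwarz_ineq2)
    also have "\<dots> \<le> (?dx + ?dy) * (4 * M)"
    proof (rule mult_mono)
      show "norm ((x r - y r) - (x s - y s)) \<le> ?dx + ?dy"
        using norm_triangle_ineq4[of "x r - x s" "y r - y s"] by (simp add: algebra_simps)
      show "norm ((x r - y r) + (x s - y s)) \<le> 4 * M"
        using norm_triangle_ineq[of "x r - y r" "x s - y s"] small[OF sr(1)] small[OF sr(2)] by linarith
    qed auto
    finally have \<psi>: "\<bar>\<psi> r - \<psi> s\<bar> \<le> (?dx + ?dy) * (4 * M)" .
    have E1: "0 \<le> E r" "E r \<le> 1" using sr C by (auto simp: E_def)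
    have Ed: "\<bar>E r - E s\<bar> \<le> 2 * C * \<bar>r - s\<bar>"
    proof -
      have "\<bar>E r - E s\<bar> \<le> \<bar>2 * C * (r - t0) - 2 * C * (s - t0)\<bar>"
        unfolding E_def using sr C by (intro exp_minus_diff_le) auto
      also have "2 * C * (r - t0) - 2 * C * (s - t0) = 2 * C * (r - s)" by (simp add: algebra_simps)
      finally show ?thesis using C by (simp add: abs_mult)
    qed
    have \<psi>s: "0 \<le> \<psi> s" "\<psi> s \<le> (2 * M)\<^sup>2"
      unfolding \<psi>_def dot_square_norm using power_mono[OF small[OF sr(1)], of 2] by auto
    have "\<phi> r - \<phi> s = E r * (\<psi> r - \<psi> s) + (E r - E s) * \<psi> s" by (simp add: \<phi>_def algebra_simps)
    also have "\<bar>\<dots>\<bar> \<le> \<bar>E r\<bar> * \<bar>\<psi> r - \<psi> s\<bar> + \<bar>E r - E s\<bar> * \<bar>\<psi> s\<bar>"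
      by (metis abs_mult abs_triangle_ineq)
    also have "\<dots> \<le> 1 * ((?dx + ?dy) * (4 * M)) + (2 * C * \<bar>r - s\<bar>) * (2 * M)\<^sup>2"
      using E1 Ed \<psi>s \<psi> C by (intro add_mono mult_mono) auto
    also have "\<dots> = 4 * M * (?dx + ?dy) + 8 * C * M\<^sup>2 * \<bar>r - s\<bar>"
      by (simp add: power2_eq_square)
    also have "\<dots> \<le> (4 * M + 8 * C * M\<^sup>2) * (?dx + ?dy) + (4 * M + 8 * C * M\<^sup>2) * \<bar>r - s\<bar>"
      using M C by (intro add_mono mult_right_mono) auto
    finally show "norm (\<phi> r - \<phi> s) \<le> (4 * M + 8 * C * M\<^sup>2) * (?dx + ?dy + \<bar>r - s\<bar>)"
      by (simp add: distrib_left)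
  qed
  moreover have "\<exists>v\<le>0. (\<phi> has_vector_derivative v) (at s within {t0..t})" if s: "s \<in> {t0..t} - N" for s
  proof -
    have sT: "s \<in> {t0..T}" using s t by auto
    obtain v1 w1 where v1: "(x has_vector_derivative v1) (at s within {t0..T})"
      "v1 = f s (x s) - w1" "w1 \<in> A s (x s) (x s)"
      using s sT unfolding N_def by blast
    obtain v2 w2 where v2: "(y has_vector_derivative v2) (at s within {t0..T})"
      "v2 = f s (y s) - w2" "w2 \<in> A s (y s) (y s)"
      using s sT unfolding N_def by blast
    let ?d = "x s - y s"
    have d: "((\<lambda>s. x s - y s) has_vector_derivative v1 - v2) (at s within {t0..t})"
      using has_vector_derivative_diff[OF v1(1) v2(1)]
      by (rule has_vector_derivative_within_subset) (use t in auto)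
    have "(\<psi> has_vector_derivative (?d \<bullet> (v1 - v2) + (v1 - v2) \<bullet> ?d)) (at s within {t0..t})"
      unfolding \<psi>_def by (rule bounded_bilinear.has_vector_derivative[OF bounded_bilinear_inner d d])
    then have "(\<psi> has_real_derivative 2 * ((v1 - v2) \<bullet> ?d)) (at s within {t0..t})"
      by (simp add: has_real_derivative_iff_has_vector_derivative inner_commute)
    moreover have "(E has_real_derivative - (2 * C) * E s) (at s within {t0..t})"
      unfolding E_def by (auto intro!: derivative_eq_intros)
    ultimately have "(\<phi> has_real_derivative
        - (2 * C) * E s * \<psi> s + 2 * ((v1 - v2) \<bullet> ?d) * E s) (at s within {t0..t})"
      unfolding \<phi>_def by (intro DERIV_mult)
    moreover have "- (2 * C) * E s * \<psi> s + 2 * ((v1 - v2) \<bullet> ?d) * E s = 2 * E s * ((v1 - v2) \<bullet> ?d - C * \<psi> s)"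
      by (simp add: algebra_simps)
    moreover have "2 * E s * ((v1 - v2) \<bullet> ?d - C * \<psi> s) \<le> 0"
    proof -
      have "(v1 - v2) \<bullet> ?d \<le> C * \<psi> s"
        using Cxy[OF sT v1(3) v2(3)] Mxy[of s] s unfolding v1(2) v2(2) \<psi>_def dot_square_norm by auto
      then show ?thesis by (intro mult_nonneg_nonpos) (auto simp: E_def)
    qed
    ultimately show ?thesis
      unfolding has_real_derivative_iff_has_vector_derivative by metis
  qed
  ultimately have "\<phi> t \<le> \<phi> t0"
    using t \<open>negligible N\<close> by (intro absolutely_continuous_antimono[of t0 t \<phi> N]) auto
  moreover have "\<phi> t0 = 0" using x y by (simp add: \<phi>_def \<psi>_def is_solution_def)
  ultimately have "E t * \<psi> t \<le> 0" unfolding \<phi>_def by linarith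
  then have "\<psi> t \<le> 0" by (simp add: E_def mult_le_0_iff)
  then show ?thesis by (simp add: \<psi>_def dot_square_norm)
qed

section \<open>Existence and uniqueness on the given time interval\<close>

theorem theorem3p2:
  fixes T L1 L2 cA cf :: real
    and A :: "real \<Rightarrow> real ^ 'n \<Rightarrow> real ^ 'n \<Rightarrow> (real ^ 'n) set"
    and f :: "real \<Rightarrow> real ^ 'n \<Rightarrow> real ^ 'n"
  assumes "T > 0"
    and "\<And>t x. t \<in> {0..T} \<Longrightarrow> maximal_monotone (A t x)"
    and "L1 \<ge> 0" and "0 \<le> L2" and "L2 < 1"
    and "\<And>t s x y. t \<in> {0..T} \<Longrightarrow> s \<in> {0..T} \<Longrightarrow>
           pseudo_dist (A t x) (A s y) \<le> ereal (L1 * \<bar>t - s\<bar> + L2 * norm (x - y))"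
    and "cA > 0"
    and "\<And>t x y. t \<in> {0..T} \<Longrightarrow> y \<in> op_dom (A t x) \<Longrightarrow>
           norm (minimal_section (A t x) y) \<le> cA * (1 + norm x + norm y)"
    and "continuous_on ({0..T} \<times> UNIV) (\<lambda>(t, x). f t x)"
    and "cf > 0"
    and "\<And>t x. t \<in> {0..T} \<Longrightarrow> norm (f t x) \<le> cf * (1 + norm x)"
    and "\<And>M::real. M > 0 \<Longrightarrow> \<exists>kM lM :: real. kM > 0 \<and> lM > 0 \<and>
           (\<forall>t\<in>{0..T}. \<forall>x1 x2. norm x1 \<le> M \<and> norm x2 \<le> M \<longrightarrow>
              (\<forall>w1\<in>A t x1 x1. \<forall>w2\<in>A t x2 x2.
                 (w1 - w2) \<bullet> (x1 - x2) \<ge> - kM * (norm (x1 - x2))\<^sup>2)) \<and>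
           (\<forall>t\<in>{0..T}. \<forall>x1 x2. norm x1 \<le> M \<and> norm x2 \<le> M \<longrightarrow>
              norm (f t x1 - f t x2) \<le> lM * norm (x1 - x2))"
  shows "\<forall>t0\<in>{0..T}. \<forall>x0. x0 \<in> op_dom (A t0 x0) \<longrightarrow>
           (\<exists>x. is_solution A f T t0 x0 x) \<and>
           (\<forall>x y. is_solution A f T t0 x0 x \<and> is_solution A f T t0 x0 y \<longrightarrow>
              (\<forall>t\<in>{t0..T}. x t = y t))"
proof (intro ballI allI impI conjI)
  fix t0 x0
  assume t0: "t0 \<in> {0..T}" and x0: "x0 \<in> op_dom (A t0 x0)"
  \<comment> \<open>Clamping time to \<open>{0..T}\<close> extends the data to all times. The clamp
    is 1-Lipschitz, so the distance bound keeps its constants, and it is the identity on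
    \<open>{t0..T}\<close>, so the solutions are the same.\<close>
  define c where "c t = max 0 (min T t)" for t
  have c: "c t \<in> {0..T}" "\<bar>c t - c s\<bar> \<le> \<bar>t - s\<bar>" for s t using assms(1) by (auto simp: c_def)
  have c_id: "c t = t" if "t \<in> {0..T}" for t using that by (auto simp: c_def)
  interpret operator_family "\<lambda>t. A (c t)" "\<lambda>t. f (c t)" L1 L2 cA cf
  proof
    show "maximal_monotone (A (c t) x)" for t x using assms(2) c(1) by blast
    show "0 \<le> L1" "0 \<le> L2" "L2 < 1" "0 \<le> cA" "0 \<le> cf" using assms by auto
    show "\<exists>\<eta>\<in>A (c t) x y. norm \<eta> \<le> cA * (1 + norm x + norm y)" if "y \<in> op_dom (A (c t) x)" for t x y
      using assms(8)[OF c(1) that] minimal_section_mem[OF assms(2)[OF c(1)] that] by blast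
    show "norm (f (c t) x) \<le> cf * (1 + norm x)" for t x using assms(11) c(1) by blast
    show "continuous_on UNIV (\<lambda>(t, x). f (c t) x)"
    proof -
      have "continuous_on UNIV (\<lambda>p. (\<lambda>(t, x). f t x) (c (fst p), snd p))"
        by (rule continuous_on_compose2[OF assms(9)])
          (use c(1) in \<open>auto simp: c_def intro!: continuous_intros\<close>)
      then show ?thesis by (simp add: case_prod_beta)
    qed
    fix \<eta> \<zeta> u v x y :: "real ^ 'n" and t s
    assume \<eta>\<zeta>: "\<eta> \<in> A (c t) x u" "\<zeta> \<in> A (c s) y v"
    have "(\<eta> - \<zeta>) \<bullet> (v - u) \<le> (L1 * \<bar>c t - c s\<bar> + L2 * norm (x - y)) * (1 + norm \<eta> + norm \<zeta>)"
      by (rule pseudo_dist_leD[OF assms(6)[OF c(1) c(1)] \<eta>\<zeta>])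
    also have "\<dots> \<le> (L1 * \<bar>t - s\<bar> + L2 * norm (x - y)) * (1 + norm \<eta> + norm \<zeta>)"
      using c(2)[of t s] assms(3) by (intro mult_right_mono add_mono mult_left_mono) auto
    finally show "(\<eta> - \<zeta>) \<bullet> (v - u) \<le> (L1 * \<bar>t - s\<bar> + L2 * norm (x - y)) * (1 + norm \<eta> + norm \<zeta>)" .
  qed
  obtain x where "is_solution (\<lambda>t. A (c t)) (\<lambda>t. f (c t)) T t0 x0 x"
    using solution_exists[of x0 t0 T] x0 t0 c_id by auto
  moreover have "is_solution (\<lambda>t. A (c t)) (\<lambda>t. f (c t)) T t0 x0 x = is_solution A f T t0 x0 x"
    unfolding is_solution_def using t0 c_id
    by (intro conj_cong refl AE_cong) (auto simp: space_restrict_space)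
  ultimately show "\<exists>x. is_solution A f T t0 x0 x" by blast
next
  fix t0 x0 x y t
  assume t0: "t0 \<in> {0..T}" and t: "t \<in> {t0..T}"
    and xy: "is_solution A f T t0 x0 x \<and> is_solution A f T t0 x0 y"
  show "x t = y t"
  proof (rule solution_unique[OF conjunct1[OF xy] conjunct2[OF xy] _ t])
    fix M :: real assume "M > 0"
    then obtain kM lM where kl: "kM > 0" "lM > 0"
      and k: "\<And>t x1 x2 w1 w2. t \<in> {0..T} \<Longrightarrow> norm x1 \<le> M \<Longrightarrow> norm x2 \<le> M \<Longrightarrow> w1 \<in> A t x1 x1 \<Longrightarrow>
        w2 \<in> A t x2 x2 \<Longrightarrow> (w1 - w2) \<bullet> (x1 - x2) \<ge> - kM * (norm (x1 - x2))\<^sup>2"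
      and l: "\<And>t x1 x2. t \<in> {0..T} \<Longrightarrow> norm x1 \<le> M \<Longrightarrow> norm x2 \<le> M \<Longrightarrow>
        norm (f t x1 - f t x2) \<le> lM * norm (x1 - x2)"
      using assms(12) by metis
    show "\<exists>C>0. \<forall>t\<in>{t0..T}. \<forall>x1 x2. \<forall>w1\<in>A t x1 x1. \<forall>w2\<in>A t x2 x2.
      norm x1 \<le> M \<longrightarrow> norm x2 \<le> M \<longrightarrow>
        ((f t x1 - w1) - (f t x2 - w2)) \<bullet> (x1 - x2) \<le> C * (norm (x1 - x2))\<^sup>2"
    \<comment> \<open>The Lipschitz bound of \<open>f\<close> contributes \<open>lM\<close>; the
      lower bound \<open>- kM\<close> for the operator enters with reversed sign.\<close>
    proof (intro exI[of _ "lM + kM"] conjI ballI allI impI)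
      fix t x1 x2 w1 w2
      assume *: "t \<in> {t0..T}" "w1 \<in> A t x1 x1" "w2 \<in> A t x2 x2" "norm x1 \<le> M" "norm x2 \<le> M"
      have tT: "t \<in> {0..T}" using * t0 by auto
      have "(f t x1 - f t x2) \<bullet> (x1 - x2) \<le> norm (f t x1 - f t x2) * norm (x1 - x2)"
        by (rule norm_cauchy_schwarz)
      also have "\<dots> \<le> lM * norm (x1 - x2) * norm (x1 - x2)"
        using l[OF tT] * by (intro mult_right_mono) auto
      finally show "((f t x1 - w1) - (f t x2 - w2)) \<bullet> (x1 - x2) \<le> (lM + kM) * (norm (x1 - x2))\<^sup>2"
        using k[OF tT *(4,5,2,3)] by (simp add: inner_diff_left power2_eq_square algebra_simps)
    qed (use kl in simp)
  qed
qed

end
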